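(* The smallest order of a ring that is symmetric, duo and noncommutative is $16$, and, up to isomorphism, the unique symmetric duo noncommutative ring of order $16$ is $\mathbb{F}_4[x;\sigma]/\langle x^2\rangle$.
   Context: All rings are associative with unity. A ring $R$ is symmetric if for all $a,b,c\in R$, $abc=0$ implies $bac=0$; right duo if $ba\in aR$ for all $a,b\in R$, left duo if $ba\in Rb$ for all $a,b\in R$, and duo if it is both right and left duo. $\sigma$ is the Frobenius automorphism $a\mapsto a^2$ of $\mathbb{F}_4$, and $\mathbb{F}_4[x;\sigma]$ is the skew polynomial ring with $xa=\sigma(a)x$ for $a\in\mathbb{F}_4$; $\langle x^2\rangle$ is the two-sided ideal generated by $x^2$. *)

theory Defs
  imports "HOL-Algebra.QuotRing" "HOL-Algebra.UnivPoly" "HOL-Library.Z2"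
begin

locale symmetric_ring = ring +
  assumes symmetric:
    "\<lbrakk>a \<in> carrier R; b \<in> carrier R; c \<in> carrier R; a \<otimes> b \<otimes> c = \<zero>\<rbrakk> \<Longrightarrow> b \<otimes> a \<otimes> c = \<zero>"

locale right_duo_ring = ring +
  assumes right_duo:
    "\<lbrakk>a \<in> carrier R; b \<in> carrier R\<rbrakk> \<Longrightarrow> b \<otimes> a \<in> a <# carrier R"

locale left_duo_ring = ring +
  assumes left_duo:
    "\<lbrakk>a \<in> carrier R; b \<in> carrier R\<rbrakk> \<Longrightarrow> b \<otimes> a \<in> carrier R #> b"

locale duo_ring = right_duo_ring + left_duo_ring

definition noncommutative_ring :: "('a, 'm) ring_scheme \<Rightarrow> bool"
  where "noncommutative_ring R \<longleftrightarrow> ring R \<and> \<not> cring R"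

lemma noncommutative_ring_iff:
  "noncommutative_ring R \<longleftrightarrow>
    ring R \<and> (\<exists>a\<in>carrier R. \<exists>b\<in>carrier R. a \<otimes>\<^bsub>R\<^esub> b \<noteq> b \<otimes>\<^bsub>R\<^esub> a)"
proof -
  have "cring R \<longleftrightarrow> (\<forall>a\<in>carrier R. \<forall>b\<in>carrier R. a \<otimes>\<^bsub>R\<^esub> b = b \<otimes>\<^bsub>R\<^esub> a)" if "ring R"
  proof
    assume "cring R"
    then show "\<forall>a\<in>carrier R. \<forall>b\<in>carrier R. a \<otimes>\<^bsub>R\<^esub> b = b \<otimes>\<^bsub>R\<^esub> a"
      by (simp add: cring.cring_simprules(14))
  next
    assume comm: "\<forall>a\<in>carrier R. \<forall>b\<in>carrier R. a \<otimes>\<^bsub>R\<^esub> b = b \<otimes>\<^bsub>R\<^esub> a"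
    interpret ring R by fact
    show "cring R"
      by (intro cring.intro comm_monoid.intro comm_monoid_axioms.intro ring_axioms
          monoid_axioms) (use comm in auto)
  qed
  then show ?thesis
    unfolding noncommutative_ring_def by auto
qed

text \<open>
  The field with four elements, as \<open>\<bbbF>\<^sub>2[\<omega>]\<close> with \<open>\<omega>\<^sup>2 = \<omega> + 1\<close>; the pair \<open>(a, b)\<close> stands for
  \<open>a + b \<omega>\<close>.
\<close>

definition F4 :: "(bit \<times> bit) ring"
  where "F4 = \<lparr>
   carrier = UNIV,
   mult = (\<lambda>(a, b) (c, d). (a * c + b * d, a * d + b * c + b * d)),
   one = (1, 0),
   zero = (0, 0),
   add = (\<lambda>(a, b) (c, d). (a + c, b + d))\<rparr>"

lemma field_F4: "field F4"
proof -
  have ex: "\<exists>y. x \<otimes>\<^bsub>F4\<^esub> y = \<one>\<^bsub>F4\<^esub>" if "x \<noteq> \<zero>\<^bsub>F4\<^esub>" for x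
  proof -
    obtain a b where x: "x = (a, b)" by (cases x)
    have "x \<otimes>\<^bsub>F4\<^esub> (a + b, b) = \<one>\<^bsub>F4\<^esub>"
      using that unfolding x F4_def by (cases a; cases b) simp_all
    then show ?thesis ..
  qed
  have carrier: "x \<in> carrier F4" for x by (simp add: F4_def)
  have add_self: "x \<oplus>\<^bsub>F4\<^esub> x = \<zero>\<^bsub>F4\<^esub>" for x by (cases x) (simp add: F4_def)
  have add_assoc: "(x \<oplus>\<^bsub>F4\<^esub> y) \<oplus>\<^bsub>F4\<^esub> z = x \<oplus>\<^bsub>F4\<^esub> (y \<oplus>\<^bsub>F4\<^esub> z)" for x y z
    by (cases x; cases y; cases z) (simp only: F4_def ring.simps monoid.simps prod.case add.assoc)
  have add_comm: "x \<oplus>\<^bsub>F4\<^esub> y = y \<oplus>\<^bsub>F4\<^esub> x" for x y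
    by (cases x; cases y) (simp only: F4_def ring.simps monoid.simps prod.case add.commute)
  have add_zero: "\<zero>\<^bsub>F4\<^esub> \<oplus>\<^bsub>F4\<^esub> x = x" for x by (cases x) (simp add: F4_def)
  have mult_comm: "x \<otimes>\<^bsub>F4\<^esub> y = y \<otimes>\<^bsub>F4\<^esub> x" for x y
    by (cases x; cases y) (simp only: F4_def ring.simps monoid.simps prod.case ac_simps)
  have mult_one: "\<one>\<^bsub>F4\<^esub> \<otimes>\<^bsub>F4\<^esub> x = x" for x by (cases x) (simp add: F4_def)
  have distr: "(x \<oplus>\<^bsub>F4\<^esub> y) \<otimes>\<^bsub>F4\<^esub> z = x \<otimes>\<^bsub>F4\<^esub> z \<oplus>\<^bsub>F4\<^esub> y \<otimes>\<^bsub>F4\<^esub> z" for x y z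
    by (cases x; cases y; cases z) (simp only: F4_def ring.simps monoid.simps prod.case distrib_left distrib_right ac_simps)
  have mult_assoc: "(x \<otimes>\<^bsub>F4\<^esub> y) \<otimes>\<^bsub>F4\<^esub> z = x \<otimes>\<^bsub>F4\<^esub> (y \<otimes>\<^bsub>F4\<^esub> z)" for x y z
    by (cases x; cases y; cases z) (simp only: F4_def ring.simps monoid.simps prod.case distrib_left distrib_right ac_simps)
  have "cring F4"
    by (rule cringI[OF abelian_groupI comm_monoidI])
      (use carrier add_self in \<open>blast intro: add_assoc add_comm add_zero mult_comm mult_one
        distr mult_assoc\<close>)+
  then show ?thesis
  proof (rule cring.cring_fieldI2)
    show "\<zero>\<^bsub>F4\<^esub> \<noteq> \<one>\<^bsub>F4\<^esub>" by (simp add: F4_def)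
    show "\<exists>b\<in>carrier F4. a \<otimes>\<^bsub>F4\<^esub> b = \<one>\<^bsub>F4\<^esub>" if "a \<in> carrier F4" "a \<noteq> \<zero>\<^bsub>F4\<^esub>" for a
      using ex[OF that(2)] carrier by blast
  qed
qed

lemma order_F4: "order F4 = 4"
proof -
  have "(UNIV :: (bit \<times> bit) set) = {(0, 0), (0, 1), (1, 0), (1, 1)}" (is "_ = ?A")
    by (auto simp del: bit_not_zero_iff bit_not_one_iff) (metis bit.exhaust)+
  then have "order F4 = card ?A"
    by (simp only: order_def F4_def partial_object.simps)
  then show ?thesis by simp
qed

definition frob_F4 :: "bit \<times> bit \<Rightarrow> bit \<times> bit"
  where "frob_F4 a = a [^]\<^bsub>F4\<^esub> (2::nat)"

lemma frob_F4_iso: "frob_F4 \<in> ring_iso F4 F4"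
proof -
  interpret field F4 by (rule field_F4)
  have fr: "frob_F4 x = x \<otimes>\<^bsub>F4\<^esub> x" for x
    by (simp add: frob_F4_def numeral_2_eq_2) (simp add: F4_def split: prod.splits)
  have e: "frob_F4 (a, b) = (a + b, b)" for a b
    unfolding fr by (cases a; cases b) (simp_all add: F4_def)
  show ?thesis
  proof (rule ring_iso_memI)
    show "bij_betw frob_F4 (carrier F4) (carrier F4)"
      by (rule bij_betwI[of _ _ _ frob_F4]) (auto simp: e F4_def simp del: bit_not_zero_iff)
    show "frob_F4 \<one>\<^bsub>F4\<^esub> = \<one>\<^bsub>F4\<^esub>" by (simp add: F4_def e)
    fix x y :: "bit \<times> bit"
    obtain a b c d where xy: "x = (a, b)" "y = (c, d)" by (cases x; cases y)
    show "frob_F4 x \<in> carrier F4" by (simp add: F4_def)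
    show "frob_F4 (x \<otimes>\<^bsub>F4\<^esub> y) = frob_F4 x \<otimes>\<^bsub>F4\<^esub> frob_F4 y"
      unfolding xy e F4_def by (cases a; cases b; cases c; cases d) (simp_all add: e)
    show "frob_F4 (x \<oplus>\<^bsub>F4\<^esub> y) = frob_F4 x \<oplus>\<^bsub>F4\<^esub> frob_F4 y"
      unfolding xy e F4_def by (cases a; cases b; cases c; cases d) (simp_all add: e)
  qed
qed

text \<open>
  The skew polynomial ring \<open>R[x;\<sigma>]\<close> with \<open>x a = \<sigma>(a) x\<close>. Its elements are the polynomials
  \<open>\<Sum>i. p i x\<^sup>i\<close> with coefficients on the left, so it differs from \<^const>\<open>UP\<close> only in the
  multiplication, where \<open>(p i x\<^sup>i) (q j x\<^sup>j) = p i \<sigma>\<^sup>i(q j) x\<^sup>i\<^sup>+\<^sup>j\<close>.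
\<close>

definition skew_UP :: "('a, 'm) ring_scheme \<Rightarrow> ('a \<Rightarrow> 'a) \<Rightarrow> ('a, nat \<Rightarrow> 'a) up_ring"
  where "skew_UP R \<sigma> = (UP R)
   \<lparr>mult := (\<lambda>p\<in>up R. \<lambda>q\<in>up R. \<lambda>n. \<Oplus>\<^bsub>R\<^esub>i \<in> {..n}. p i \<otimes>\<^bsub>R\<^esub> (\<sigma> ^^ i) (q (n - i)))\<rparr>"

definition skew_X :: "('a, 'm) ring_scheme \<Rightarrow> ('a \<Rightarrow> 'a) \<Rightarrow> nat \<Rightarrow> 'a"
  where "skew_X R \<sigma> = monom (skew_UP R \<sigma>) \<one>\<^bsub>R\<^esub> 1"

lemma skew_X_mult_const:
  assumes "ring R" "a \<in> carrier R" "\<sigma> \<in> ring_hom R R"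
  shows "skew_X R \<sigma> \<otimes>\<^bsub>skew_UP R \<sigma>\<^esub> monom (skew_UP R \<sigma>) a 0 =
    monom (skew_UP R \<sigma>) (\<sigma> a) 0 \<otimes>\<^bsub>skew_UP R \<sigma>\<^esub> skew_X R \<sigma>"
proof -
  interpret ring R by fact
  have s: "\<sigma> a \<in> carrier R" "\<sigma> \<zero>\<^bsub>R\<^esub> = \<zero>\<^bsub>R\<^esub>"
    using assms ring_hom_closed ring_hom_zero[OF assms(3)] by (auto simp: ring_axioms)
  have up: "(\<lambda>i. if i = k then c else \<zero>\<^bsub>R\<^esub>) \<in> up R" if "c \<in> carrier R" for c and k :: nat
    using that by (force simp: up_def)
  have L: "(\<Oplus>\<^bsub>R\<^esub>i\<in>{..n}. (if i = 1 then \<one>\<^bsub>R\<^esub> else \<zero>\<^bsub>R\<^esub>) \<otimes>\<^bsub>R\<^esub> (\<sigma> ^^ i) (if n - i = 0 then a else \<zero>\<^bsub>R\<^esub>))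
      = (if n = 1 then \<sigma> a else \<zero>\<^bsub>R\<^esub>)" for n
  proof -
    have "(\<Oplus>\<^bsub>R\<^esub>i\<in>{..n}. (if i = 1 then \<one>\<^bsub>R\<^esub> else \<zero>\<^bsub>R\<^esub>) \<otimes>\<^bsub>R\<^esub> (\<sigma> ^^ i) (if n - i = 0 then a else \<zero>\<^bsub>R\<^esub>))
      = (\<Oplus>\<^bsub>R\<^esub>i\<in>{..n}. if n = i then (if n = 1 then \<sigma> a else \<zero>\<^bsub>R\<^esub>) else \<zero>\<^bsub>R\<^esub>)"
    proof (rule finsum_cong')
      have pw: "(\<sigma> ^^ i) b \<in> carrier R" if "b \<in> carrier R" for i b
        using that by (induction i) (auto intro: ring_hom_closed[OF assms(3)])
      fix i assume "i \<in> {..n}"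
      then show "(if i = 1 then \<one>\<^bsub>R\<^esub> else \<zero>\<^bsub>R\<^esub>) \<otimes>\<^bsub>R\<^esub> (\<sigma> ^^ i) (if n - i = 0 then a else \<zero>\<^bsub>R\<^esub>)
        = (if n = i then (if n = 1 then \<sigma> a else \<zero>\<^bsub>R\<^esub>) else \<zero>\<^bsub>R\<^esub>)"
        using s pw assms(2) by (cases "i = 1") auto
    qed (use s in auto)
    also have "\<dots> = (if n = 1 then \<sigma> a else \<zero>\<^bsub>R\<^esub>)"
      using s add.finprod_singleton[of n "{..n}" "\<lambda>_. if n = 1 then \<sigma> a else \<zero>\<^bsub>R\<^esub>"] by simp
    finally show ?thesis .
  qed
  have Rr: "(\<Oplus>\<^bsub>R\<^esub>i\<in>{..n}. (if i = 0 then \<sigma> a else \<zero>\<^bsub>R\<^esub>) \<otimes>\<^bsub>R\<^esub> (\<sigma> ^^ i) (if n - i = 1 then \<one>\<^bsub>R\<^esub> else \<zero>\<^bsub>R\<^esub>))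
      = (if n = 1 then \<sigma> a else \<zero>\<^bsub>R\<^esub>)" for n
  proof -
    have "(\<Oplus>\<^bsub>R\<^esub>i\<in>{..n}. (if i = 0 then \<sigma> a else \<zero>\<^bsub>R\<^esub>) \<otimes>\<^bsub>R\<^esub> (\<sigma> ^^ i) (if n - i = 1 then \<one>\<^bsub>R\<^esub> else \<zero>\<^bsub>R\<^esub>))
      = (\<Oplus>\<^bsub>R\<^esub>i\<in>{..n}. if 0 = i then (if n = 1 then \<sigma> a else \<zero>\<^bsub>R\<^esub>) else \<zero>\<^bsub>R\<^esub>)"
    proof (rule finsum_cong')
      have pw: "(\<sigma> ^^ i) b \<in> carrier R" if "b \<in> carrier R" for i b
        using that by (induction i) (auto intro: ring_hom_closed[OF assms(3)])
      fix i assume "i \<in> {..n}"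
      then show "(if i = 0 then \<sigma> a else \<zero>\<^bsub>R\<^esub>) \<otimes>\<^bsub>R\<^esub> (\<sigma> ^^ i) (if n - i = 1 then \<one>\<^bsub>R\<^esub> else \<zero>\<^bsub>R\<^esub>)
        = (if 0 = i then (if n = 1 then \<sigma> a else \<zero>\<^bsub>R\<^esub>) else \<zero>\<^bsub>R\<^esub>)"
        using s pw assms(2) by (cases "i = 0") auto
    qed (use s in auto)
    also have "\<dots> = (if n = 1 then \<sigma> a else \<zero>\<^bsub>R\<^esub>)"
      using s add.finprod_singleton[of 0 "{..n}" "\<lambda>_. if n = 1 then \<sigma> a else \<zero>\<^bsub>R\<^esub>"] by simp
    finally show ?thesis .
  qed
  show ?thesis
    using up[of _ 0] up[of _ 1] s(1) assms(2) L Rr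
    by (simp add: skew_X_def skew_UP_def UP_def)
qed

definition F4_skew_quot :: "(nat \<Rightarrow> bit \<times> bit) set ring"
  where "F4_skew_quot =
    (let S = skew_UP F4 frob_F4 in S Quot (Idl\<^bsub>S\<^esub> {skew_X F4 frob_F4 [^]\<^bsub>S\<^esub> (2::nat)}))"

end

theory Submission
  imports Defs
begin

text \<open>
  A symmetric ring with unity is reversible: \<open>ab = 0\<close> implies \<open>ba = 0\<close>. In a reversible ring idempotents are central, so a noncommutative \<open>R\<close> with
  at most 16 elements and a nontrivial idempotent has a noncommutative corner with at most 8
  elements; by induction \<open>R\<close> has only trivial idempotents, and being finite it is local with
  nil ideal \<open>N\<close> of nonunits. If \<open>N = 0\<close>, counting a centralizer gives \<open>a\<^sup>2 = a + 1\<close> for every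
  noncentral \<open>a\<close>, which is absurd. Otherwise some \<open>s \<noteq> 0\<close> satisfies \<open>s N = N s = 0\<close>. If every
  element is central modulo \<open>N\<close>, then \<open>|N| \<le> 8\<close>, and noncommuting \<open>a, b \<in> N\<close> would force
  \<open>ab, ba \<in> {0, s}\<close>, hence \<open>ab = ba\<close> by reversibility. Otherwise take \<open>w\<close> that is not central
  modulo \<open>N\<close>: the cosets of \<open>0, 1, w, w + 1\<close> are distinct and \<open>0, s, ws, (w + 1)s\<close> are distinct
  elements of \<open>N\<close>, so \<open>|N| = 4\<close> and \<open>|R| = 16\<close>. Elements of \<open>N\<close> commuting with \<open>w\<close> vanish, which
  yields \<open>2 = 0\<close> and \<open>w\<^sup>2 = w + 1\<close>, and \<open>s w = (w + 1) s\<close> is the only remaining possibility.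
\<close>

section \<open>Skew polynomials modulo the square of the variable\<close>

locale skew_poly = ring R for R (structure) +
  fixes \<sigma> :: "'a \<Rightarrow> 'a"
  assumes hom: "\<sigma> \<in> ring_hom R R"
begin

lemma funpow_hom: "\<sigma> ^^ i \<in> ring_hom R R"
  by (induction i)
    (use hom in \<open>auto intro!: ring_hom_memI simp: ring_hom_closed ring_hom_mult ring_hom_add ring_hom_one\<close>)

lemma funpow_closed [simp]: "x \<in> carrier R \<Longrightarrow> (\<sigma> ^^ i) x \<in> carrier R"
  by (rule ring_hom_closed[OF funpow_hom])

lemma funpow_times [simp]:
  "x \<in> carrier R \<Longrightarrow> y \<in> carrier R \<Longrightarrow> (\<sigma> ^^ i) (x \<otimes> y) = (\<sigma> ^^ i) x \<otimes> (\<sigma> ^^ i) y"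
  by (rule ring_hom_mult[OF funpow_hom])

lemma funpow_plus [simp]:
  "x \<in> carrier R \<Longrightarrow> y \<in> carrier R \<Longrightarrow> (\<sigma> ^^ i) (x \<oplus> y) = (\<sigma> ^^ i) x \<oplus> (\<sigma> ^^ i) y"
  by (rule ring_hom_add[OF funpow_hom])

lemma funpow_const [simp]: "(\<sigma> ^^ i) \<zero> = \<zero>" "(\<sigma> ^^ i) \<one> = \<one>"
  using ring_hom_zero[OF funpow_hom] ring_hom_one[OF funpow_hom] ring_axioms by auto

text \<open>This is the product of \<open>skew_UP\<close> without its restriction to
  \<open>up R\<close>, so it can be unfolded before membership of the factors is known.\<close>

definition conv :: "(nat \<Rightarrow> 'a) \<Rightarrow> (nat \<Rightarrow> 'a) \<Rightarrow> nat \<Rightarrow> 'a"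
  where "conv p q n = (\<Oplus>i\<in>{..n}. p i \<otimes> (\<sigma> ^^ i) (q (n - i)))"

lemma conv_closed:
  assumes "p \<in> up R" "q \<in> up R"
  shows "conv p q \<in> up R"
proof
  have [simp]: "p i \<in> carrier R" "q i \<in> carrier R" for i
    using assms by (simp_all add: mem_upD)
  show "conv p q n \<in> carrier R" for n
    by (simp add: conv_def Pi_def)
  obtain n m where n: "bound \<zero> n p" and m: "bound \<zero> m q"
    using assms by blast
  have "bound \<zero> (n + m) (conv p q)"
  proof
    fix k assume k: "n + m < k"
    have "p i \<otimes> (\<sigma> ^^ i) (q (k - i)) = \<zero>" for i
    proof (cases "n < i")
      case True
      then have "p i = \<zero>" using n by blast
      then show ?thesis by simp
    next
      case False
      then have "q (k - i) = \<zero>" using k by (intro bound.bound[OF m]) simp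
      then show ?thesis by simp
    qed
    then show "conv p q k = \<zero>" by (simp add: conv_def)
  qed
  then show "\<exists>n. bound \<zero> n (conv p q)" ..
qed

text \<open>Both sides sum twisted products of a \<open>p i\<close>, a \<open>q j\<close> and an
  \<open>r l\<close> over i + j + l = n. The induction keeps \<open>n\<close> fixed and truncates to
  i + j \<le> \<open>k\<close>, so each step adds only the terms with i + j =
  \<open>Suc k\<close>.\<close>

lemma conv_assoc:
  assumes "p \<in> up R" "q \<in> up R" "r \<in> up R"
  shows "conv (conv p q) r = conv p (conv q r)"
proof
  fix n
  have [simp]: "p i \<in> carrier R" "q i \<in> carrier R" "r i \<in> carrier R" for i
    using assms by (simp_all add: mem_upD)
  have "(\<Oplus>j\<in>{..k}. (\<Oplus>i\<in>{..j}. p i \<otimes> (\<sigma> ^^ i) (q (j - i))) \<otimes> (\<sigma> ^^ j) (r (n - j))) =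
    (\<Oplus>j\<in>{..k}. p j \<otimes> (\<sigma> ^^ j) (\<Oplus>i\<in>{..k-j}. q i \<otimes> (\<sigma> ^^ i) (r (n - j - i))))"
    if "k \<le> n" for k
    using that
  proof (induction k)
    case 0
    then show ?case by (simp add: m_assoc)
  next
    case (Suc k)
    have eq: "p j \<otimes> (\<sigma> ^^ j) (\<Oplus>i\<in>{..Suc k-j}. q i \<otimes> (\<sigma> ^^ i) (r (n - j - i))) =
        p j \<otimes> (\<sigma> ^^ j) (q (Suc k - j)) \<otimes> (\<sigma> ^^ Suc k) (r (n - Suc k)) \<oplus>
        p j \<otimes> (\<sigma> ^^ j) (\<Oplus>i\<in>{..k-j}. q i \<otimes> (\<sigma> ^^ i) (r (n - j - i)))" if "j \<in> {..k}" for j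
    proof -
      \<comment> \<open>This concerns the top term of the inner sum, split off by
        \<open>Suc_diff_le\<close>: for \<open>j\<close> \<le> \<open>k\<close> the two twists
        compose to \<open>\<sigma> ^^ Suc k\<close>.\<close>
      have "(\<sigma> ^^ j) ((\<sigma> ^^ Suc (k - j)) x) = (\<sigma> ^^ Suc k) x" for x
        using that funpow_add[of j "Suc (k - j)" \<sigma>] by (simp del: funpow.simps)
      moreover have "n - j - Suc (k - j) = n - Suc k" using that by simp
      ultimately show ?thesis
        using that by (simp del: funpow.simps add: Suc_diff_le Pi_def r_distr m_assoc)
    qed
    have "(\<Oplus>j\<in>{..Suc k}. p j \<otimes> (\<sigma> ^^ j) (\<Oplus>i\<in>{..Suc k-j}. q i \<otimes> (\<sigma> ^^ i) (r (n - j - i)))) =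
      p (Suc k) \<otimes> (\<sigma> ^^ Suc k) (q 0 \<otimes> r (n - Suc k)) \<oplus>
      (\<Oplus>j\<in>{..k}. p j \<otimes> (\<sigma> ^^ j) (q (Suc k - j)) \<otimes> (\<sigma> ^^ Suc k) (r (n - Suc k)) \<oplus>
        p j \<otimes> (\<sigma> ^^ j) (\<Oplus>i\<in>{..k-j}. q i \<otimes> (\<sigma> ^^ i) (r (n - j - i))))"
      by (subst finsum_Suc) (simp_all del: funpow.simps diff_diff_left add: eq Pi_def cong: finsum_cong)
    also have "\<dots> = p (Suc k) \<otimes> (\<sigma> ^^ Suc k) (q 0) \<otimes> (\<sigma> ^^ Suc k) (r (n - Suc k)) \<oplus>
      ((\<Oplus>j\<in>{..k}. p j \<otimes> (\<sigma> ^^ j) (q (Suc k - j))) \<otimes> (\<sigma> ^^ Suc k) (r (n - Suc k)) \<oplus>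
       (\<Oplus>j\<in>{..k}. (\<Oplus>i\<in>{..j}. p i \<otimes> (\<sigma> ^^ i) (q (j - i))) \<otimes> (\<sigma> ^^ j) (r (n - j))))"
      using Suc by (simp del: funpow.simps add: Pi_def finsum_ldistr m_assoc finsum_addf)
    finally show ?case
      by (simp del: funpow.simps add: Pi_def l_distr a_assoc)
  qed
  from this[of n] show "conv (conv p q) r n = conv p (conv q r) n"
    by (simp add: conv_def)
qed

lemma skew_UP_simps:
  "carrier (skew_UP R \<sigma>) = up R"
  "\<one>\<^bsub>skew_UP R \<sigma>\<^esub> = (\<lambda>i. if i = 0 then \<one> else \<zero>)"
  "\<zero>\<^bsub>skew_UP R \<sigma>\<^esub> = (\<lambda>i. \<zero>)"
  "p \<in> up R \<Longrightarrow> q \<in> up R \<Longrightarrow> p \<oplus>\<^bsub>skew_UP R \<sigma>\<^esub> q = (\<lambda>i. p i \<oplus> q i)"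
  "p \<in> up R \<Longrightarrow> q \<in> up R \<Longrightarrow> p \<otimes>\<^bsub>skew_UP R \<sigma>\<^esub> q = conv p q"
  by (simp_all add: skew_UP_def UP_def conv_def[abs_def])

lemma conv_monom:
  assumes "p \<in> up R" "c \<in> carrier R"
  shows "conv p (\<lambda>i. if i = k then c else \<zero>) n =
    (if k \<le> n then p (n - k) \<otimes> (\<sigma> ^^ (n - k)) c else \<zero>)"
proof -
  \<comment> \<open>For \<open>n\<close> < \<open>k\<close> the truncated difference
    \<open>n - k\<close> is 0, so the index test alone would keep the term at 0. The inner test
    \<open>k \<le> n\<close> removes it.\<close>
  have "conv p (\<lambda>i. if i = k then c else \<zero>) n =
    (\<Oplus>i\<in>{..n}. if n - k = i then (if k \<le> n then p i \<otimes> (\<sigma> ^^ i) c else \<zero>) else \<zero>)"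
    unfolding conv_def using assms by (intro finsum_cong') (auto simp: mem_upD)
  also have "\<dots> = (if k \<le> n then p (n - k) \<otimes> (\<sigma> ^^ (n - k)) c else \<zero>)"
    using assms add.finprod_singleton[of "n - k" "{..n}" "\<lambda>i. if k \<le> n then p i \<otimes> (\<sigma> ^^ i) c else \<zero>"]
    by (simp add: Pi_def mem_upD)
  finally show ?thesis .
qed

lemma conv_one_left:
  assumes "p \<in> up R"
  shows "conv (\<lambda>i. if i = 0 then \<one> else \<zero>) p = p"
proof
  fix n
  have "conv (\<lambda>i. if i = 0 then \<one> else \<zero>) p n = (\<Oplus>i\<in>{..n}. if 0 = i then p n else \<zero>)"
    unfolding conv_def using assms by (intro finsum_cong') (auto simp: mem_upD)
  also have "\<dots> = p n"
    using assms add.finprod_singleton[of 0 "{..n}" "\<lambda>i. p n"] by (simp add: Pi_def mem_upD)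
  finally show "conv (\<lambda>i. if i = 0 then \<one> else \<zero>) p n = p n" .
qed

text \<open>Only the multiplication differs from \<open>UP R\<close>, so the additive group is taken
  over from there and the convolution lemmas supply the rest.\<close>

lemma ring_skew_UP: "ring (skew_UP R \<sigma>)"
proof -
  interpret P: UP_ring R "UP R" by unfold_locales auto
  interpret P: ring "UP R" by (rule P.UP_ring)
  have ab: "abelian_group (skew_UP R \<sigma>)"
  proof (rule abelian_groupI)
    have e: "carrier (skew_UP R \<sigma>) = carrier (UP R)" "add (skew_UP R \<sigma>) = add (UP R)"
      "zero (skew_UP R \<sigma>) = zero (UP R)"
      by (simp_all add: skew_UP_def)
    show "\<exists>y\<in>carrier (skew_UP R \<sigma>). y \<oplus>\<^bsub>skew_UP R \<sigma>\<^esub> x = \<zero>\<^bsub>skew_UP R \<sigma>\<^esub>"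
      if "x \<in> carrier (skew_UP R \<sigma>)" for x
      using that P.add.l_inv_ex unfolding e by simp
  qed (simp_all add: skew_UP_def P.a_ac)
  show ?thesis
  proof (rule ringI[OF ab monoidI])
    fix p q r assume "p \<in> carrier (skew_UP R \<sigma>)" "q \<in> carrier (skew_UP R \<sigma>)" "r \<in> carrier (skew_UP R \<sigma>)"
    then have [simp]: "p \<in> up R" "q \<in> up R" "r \<in> up R" by (simp_all add: skew_UP_simps)
    then have [simp]: "p i \<in> carrier R" "q i \<in> carrier R" "r i \<in> carrier R" for i
      by (simp_all only: mem_upD)
    show "(p \<oplus>\<^bsub>skew_UP R \<sigma>\<^esub> q) \<otimes>\<^bsub>skew_UP R \<sigma>\<^esub> r = p \<otimes>\<^bsub>skew_UP R \<sigma>\<^esub> r \<oplus>\<^bsub>skew_UP R \<sigma>\<^esub> q \<otimes>\<^bsub>skew_UP R \<sigma>\<^esub> r"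
      by (simp add: skew_UP_simps conv_closed up_add_closed)
       (simp add: conv_def[abs_def] l_distr finsum_addf Pi_def)
    show "r \<otimes>\<^bsub>skew_UP R \<sigma>\<^esub> (p \<oplus>\<^bsub>skew_UP R \<sigma>\<^esub> q) = r \<otimes>\<^bsub>skew_UP R \<sigma>\<^esub> p \<oplus>\<^bsub>skew_UP R \<sigma>\<^esub> r \<otimes>\<^bsub>skew_UP R \<sigma>\<^esub> q"
      by (simp add: skew_UP_simps conv_closed up_add_closed)
       (simp add: conv_def[abs_def] r_distr finsum_addf Pi_def)
  qed (auto simp: skew_UP_simps conv_closed conv_assoc up_one_closed conv_one_left conv_monom mem_upD)
qed

section \<open>Skew dual numbers and the quotient by the square of the variable\<close>

text \<open>The pair \<open>(a, b)\<close> stands for \<open>a + b x\<close> with \<open>x\<^sup>2 = 0\<close>.\<close>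

definition skew_dual :: "('a \<times> 'a) ring"
  where "skew_dual = \<lparr>
   carrier = carrier R \<times> carrier R,
   mult = (\<lambda>(a, b) (c, d). (a \<otimes> c, a \<otimes> d \<oplus> b \<otimes> \<sigma> c)),
   one = (\<one>, \<zero>),
   zero = (\<zero>, \<zero>),
   add = (\<lambda>(a, b) (c, d). (a \<oplus> c, b \<oplus> d))\<rparr>"

lemma sigma_simps [simp]:
  "x \<in> carrier R \<Longrightarrow> \<sigma> x \<in> carrier R"
  "x \<in> carrier R \<Longrightarrow> y \<in> carrier R \<Longrightarrow> \<sigma> (x \<otimes> y) = \<sigma> x \<otimes> \<sigma> y"
  "x \<in> carrier R \<Longrightarrow> y \<in> carrier R \<Longrightarrow> \<sigma> (x \<oplus> y) = \<sigma> x \<oplus> \<sigma> y"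
  "\<sigma> \<zero> = \<zero>" "\<sigma> \<one> = \<one>"
  using funpow_closed[of _ 1] funpow_times[of _ _ 1] funpow_plus[of _ _ 1] funpow_const[of 1] by simp_all

lemma ring_skew_dual: "ring skew_dual"
proof (rule ringI[OF abelian_groupI monoidI])
  fix x assume "x \<in> carrier skew_dual"
  then obtain a b where x: "x = (a, b)" "a \<in> carrier R" "b \<in> carrier R"
    by (auto simp: skew_dual_def)
  then show "\<exists>y\<in>carrier skew_dual. y \<oplus>\<^bsub>skew_dual\<^esub> x = \<zero>\<^bsub>skew_dual\<^esub>"
    by (intro bexI[of _ "(\<ominus> a, \<ominus> b)"]) (simp_all add: skew_dual_def l_neg)
qed (auto simp: skew_dual_def l_distr r_distr m_assoc a_ac)

text \<open>Truncation modulo x^2, written in the coordinates of \<open>skew_dual\<close>.\<close>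

definition coeffs_01 :: "(nat \<Rightarrow> 'a) \<Rightarrow> 'a \<times> 'a"
  where "coeffs_01 p = (p 0, p 1)"

lemma coeffs_01_hom: "ring_hom_ring (skew_UP R \<sigma>) skew_dual coeffs_01"
proof (rule ring_hom_ringI2[OF ring_skew_UP ring_skew_dual ring_hom_memI])
  fix p q assume "p \<in> carrier (skew_UP R \<sigma>)" "q \<in> carrier (skew_UP R \<sigma>)"
  then have [simp]: "p \<in> up R" "q \<in> up R" by (simp_all add: skew_UP_simps)
  then have [simp]: "p i \<in> carrier R" "q i \<in> carrier R" for i by (simp_all only: mem_upD)
  have "(\<Oplus>i\<in>{..1}. p i \<otimes> (\<sigma> ^^ i) (q (1 - i))) = p 0 \<otimes> q 1 \<oplus> p 1 \<otimes> \<sigma> (q 0)"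
    using finsum_Suc[of "\<lambda>i. p i \<otimes> (\<sigma> ^^ i) (q (1 - i))" 0] by (simp add: Pi_def a_ac)
  then show "coeffs_01 (p \<otimes>\<^bsub>skew_UP R \<sigma>\<^esub> q) = coeffs_01 p \<otimes>\<^bsub>skew_dual\<^esub> coeffs_01 q"
    by (simp add: skew_UP_simps coeffs_01_def skew_dual_def conv_def)
  show "coeffs_01 (p \<oplus>\<^bsub>skew_UP R \<sigma>\<^esub> q) = coeffs_01 p \<oplus>\<^bsub>skew_dual\<^esub> coeffs_01 q"
    by (simp add: skew_UP_simps coeffs_01_def skew_dual_def)
qed (auto simp: skew_UP_simps coeffs_01_def skew_dual_def mem_upD)

lemma coeffs_01_surj: "coeffs_01 ` carrier (skew_UP R \<sigma>) = carrier skew_dual"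
proof -
  have "x \<in> coeffs_01 ` carrier (skew_UP R \<sigma>)" if x: "x \<in> carrier skew_dual" for x
  proof
    define p where "p = (\<lambda>i::nat. if i = 0 then fst x else if i = 1 then snd x else \<zero>)"
    have c: "fst x \<in> carrier R" "snd x \<in> carrier R" using x by (auto simp: skew_dual_def)
    show "x = coeffs_01 p" by (simp add: coeffs_01_def p_def)
    have "bound \<zero> 1 p" by (auto simp: p_def)
    moreover have "p i \<in> carrier R" for i using c by (simp add: p_def)
    ultimately show "p \<in> carrier (skew_UP R \<sigma>)" unfolding skew_UP_simps by blast
  qed
  then show ?thesis
    by (auto simp: skew_UP_simps coeffs_01_def skew_dual_def mem_upD)
qed

lemma skew_X_square: "skew_X R \<sigma> [^]\<^bsub>skew_UP R \<sigma>\<^esub> (2::nat) = (\<lambda>i. if i = 2 then \<one> else \<zero>)"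
proof -
  interpret P: ring "skew_UP R \<sigma>" by (rule ring_skew_UP)
  have X: "skew_X R \<sigma> = (\<lambda>i. if i = 1 then \<one> else \<zero>)"
    by (simp add: skew_X_def skew_UP_def UP_def)
  have up: "skew_X R \<sigma> \<in> up R" unfolding X by (force simp: up_def)
  have "skew_X R \<sigma> [^]\<^bsub>skew_UP R \<sigma>\<^esub> (2::nat) = conv (skew_X R \<sigma>) (skew_X R \<sigma>)"
    using up by (simp add: numeral_2_eq_2 skew_UP_simps up_one_closed conv_one_left)
  also have "\<dots> = (\<lambda>i. if i = 2 then \<one> else \<zero>)"
  proof
    fix n
    show "conv (skew_X R \<sigma>) (skew_X R \<sigma>) n = (if n = 2 then \<one> else \<zero>)"
      using conv_monom[OF up one_closed, of 1 n] unfolding X[symmetric] by (auto simp: X)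
  qed
  finally show ?thesis .
qed

lemma coeffs_01_kernel_eq:
  "a_kernel (skew_UP R \<sigma>) skew_dual coeffs_01 = {p \<in> up R. p 0 = \<zero> \<and> p 1 = \<zero>}"
  unfolding a_kernel_def' skew_UP_simps by (simp add: coeffs_01_def skew_dual_def)

text \<open>A polynomial without terms of degree 0 and 1 is a left multiple q x^2, where
  \<open>q\<close> is its shift by two. The twist does not interfere because \<sigma> fixes the
  coefficient 1 of x^2.\<close>

lemma coeffs_01_kernel:
  "a_kernel (skew_UP R \<sigma>) skew_dual coeffs_01 =
    Idl\<^bsub>skew_UP R \<sigma>\<^esub> {skew_X R \<sigma> [^]\<^bsub>skew_UP R \<sigma>\<^esub> (2::nat)}"
    (is "?K = Idl\<^bsub>?P\<^esub> {?x2}")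
proof
  have x2: "?x2 \<in> up R" unfolding skew_X_square by (force simp: up_def)
  then have "?x2 \<in> ?K" unfolding coeffs_01_kernel_eq skew_X_square by simp
  then show "Idl\<^bsub>?P\<^esub> {?x2} \<subseteq> ?K"
    by (intro ring.genideal_minimal[OF ring_skew_UP] ring_hom_ring.kernel_is_ideal[OF coeffs_01_hom]) blast
  have x2P: "{?x2} \<subseteq> carrier ?P" using x2 skew_UP_simps(1) by blast
  show "?K \<subseteq> Idl\<^bsub>?P\<^esub> {?x2}"
  proof
    fix p assume "p \<in> ?K"
    then have p: "p \<in> up R" and p01: "p 0 = \<zero>" "p 1 = \<zero>"
      unfolding coeffs_01_kernel_eq by auto
    define q where "q = (\<lambda>n. p (n + 2))"
    obtain n where n: "bound \<zero> n p" using p by blast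
    have q: "q \<in> up R"
    proof
      show "q i \<in> carrier R" for i using p by (simp add: q_def mem_upD)
      have "bound \<zero> n q" using bound.bound[OF n] by (auto simp: q_def)
      then show "\<exists>n. bound \<zero> n q" ..
    qed
    have "conv q ?x2 n = p n" for n
    proof (cases "2 \<le> n")
      case True
      then have "q (n - 2) = p n" unfolding q_def by (metis le_add_diff_inverse2)
      then show ?thesis
        using True p conv_monom[OF q one_closed, of 2 n] unfolding skew_X_square
        by (simp add: mem_upD)
    next
      case False
      then have "n = 0 \<or> n = 1" by arith
      then show ?thesis
        using False p01 conv_monom[OF q one_closed, of 2 n] unfolding skew_X_square by auto
    qed
    then have "q \<otimes>\<^bsub>?P\<^esub> ?x2 = p" unfolding skew_UP_simps(5)[OF q x2] ..
    then show "p \<in> Idl\<^bsub>?P\<^esub> {?x2}"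
      using ideal.I_l_closed[OF ring.genideal_ideal[OF ring_skew_UP x2P], of ?x2 q]
        ring.genideal_self[OF ring_skew_UP x2P] q skew_UP_simps(1) by auto
  qed
qed

lemma skew_UP_Quot_iso:
  "skew_UP R \<sigma> Quot (Idl\<^bsub>skew_UP R \<sigma>\<^esub> {skew_X R \<sigma> [^]\<^bsub>skew_UP R \<sigma>\<^esub> (2::nat)}) \<simeq> skew_dual"
  using ring_hom_ring.FactRing_iso[OF coeffs_01_hom coeffs_01_surj] unfolding coeffs_01_kernel .

lemma ring_skew_UP_Quot:
  "ring (skew_UP R \<sigma> Quot (Idl\<^bsub>skew_UP R \<sigma>\<^esub> {skew_X R \<sigma> [^]\<^bsub>skew_UP R \<sigma>\<^esub> (2::nat)}))"
  using ideal.quotient_is_ring[OF ring_hom_ring.kernel_is_ideal[OF coeffs_01_hom]]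
  unfolding coeffs_01_kernel .

end

section \<open>Skew dual numbers over a field with an automorphism\<close>

locale skew_dual_field = field R for R (structure) +
  fixes \<sigma> :: "'a \<Rightarrow> 'a"
  assumes iso: "\<sigma> \<in> ring_iso R R"
begin

sublocale skew_poly R \<sigma>
  using iso by unfold_locales (auto simp: ring_iso_def)

lemma sigma_eq_zero_iff [simp]: "x \<in> carrier R \<Longrightarrow> \<sigma> x = \<zero> \<longleftrightarrow> x = \<zero>"
  using inj_on_eq_iff[OF bij_betw_imp_inj_on[OF ring_iso_memE(5)[OF iso]], of x \<zero>] by simp

lemma sigma_surj: "y \<in> carrier R \<Longrightarrow> \<exists>x\<in>carrier R. \<sigma> x = y"
  using bij_betw_imp_surj_on[OF ring_iso_memE(5)[OF iso]] by (metis imageE)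

text \<open>The constant term abc of the product vanishes, so one of a, b, c is zero and at most one
  summand of the linear coefficient survives. Swapping the first two factors changes only which
  field elements are twisted, and \<sigma> does not affect whether an element is zero.\<close>

lemma symmetric_skew_dual: "symmetric_ring skew_dual"
proof (intro symmetric_ring.intro symmetric_ring_axioms.intro ring_skew_dual)
  fix x y z assume "x \<in> carrier skew_dual" "y \<in> carrier skew_dual" "z \<in> carrier skew_dual"
    and zero: "x \<otimes>\<^bsub>skew_dual\<^esub> y \<otimes>\<^bsub>skew_dual\<^esub> z = \<zero>\<^bsub>skew_dual\<^esub>"
  then obtain a a' b b' c c' where xyz: "x = (a, a')" "y = (b, b')" "z = (c, c')"
    and [simp]: "a \<in> carrier R" "a' \<in> carrier R" "b \<in> carrier R" "b' \<in> carrier R"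
      "c \<in> carrier R" "c' \<in> carrier R"
    by (auto simp: skew_dual_def)
  have "a = \<zero> \<or> b = \<zero> \<or> c = \<zero>" using zero by (auto simp: xyz skew_dual_def integral_iff)
  then show "y \<otimes>\<^bsub>skew_dual\<^esub> x \<otimes>\<^bsub>skew_dual\<^esub> z = \<zero>\<^bsub>skew_dual\<^esub>"
    using zero by (elim disjE) (auto simp: xyz skew_dual_def integral_iff)
qed

text \<open>If the relevant constant term is zero, a scalar can be carried across the remaining
  multiple of the variable, at the price of \<sigma> or its inverse. Otherwise the constant term is
  invertible and the linear coefficient of the required factor is found by division.\<close>

lemma duo_skew_dual: "duo_ring skew_dual"
proof (intro duo_ring.intro right_duo_ring.intro right_duo_ring_axioms.intro
    left_duo_ring.intro left_duo_ring_axioms.intro ring_skew_dual)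
  fix x y assume "x \<in> carrier skew_dual" "y \<in> carrier skew_dual"
  then obtain a a' b b' where xy: "x = (a, a')" "y = (b, b')"
    and [simp]: "a \<in> carrier R" "a' \<in> carrier R" "b \<in> carrier R" "b' \<in> carrier R"
    by (auto simp: skew_dual_def)
  show "y \<otimes>\<^bsub>skew_dual\<^esub> x \<in> x <#\<^bsub>skew_dual\<^esub> carrier skew_dual"
  proof (cases "a = \<zero>")
    case True
    \<comment> \<open>Here yx has linear coefficient b a', while multiplying x on the right by (d,
      0) gives a' \<sigma>(d).\<close>
    obtain d where "d \<in> carrier R" "\<sigma> d = b" using sigma_surj[of b] by auto
    then have "(d, \<zero>) \<in> carrier skew_dual" "y \<otimes>\<^bsub>skew_dual\<^esub> x = x \<otimes>\<^bsub>skew_dual\<^esub> (d, \<zero>)"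
      using True by (simp_all add: xy skew_dual_def m_comm)
    then show ?thesis unfolding l_coset_def by blast
  next
    case False
    \<comment> \<open>This solves a d + a' \<sigma>(b) = b a' + b' \<sigma>(a), the equality of the
      linear coefficients of x (b, d) and yx.\<close>
    define d where "d = inv a \<otimes> (b \<otimes> a' \<oplus> b' \<otimes> \<sigma> a \<ominus> a' \<otimes> \<sigma> b)"
    have [simp]: "d \<in> carrier R" "inv a \<in> carrier R" "a \<otimes> inv a = \<one>"
      using False field_Units by (auto simp: d_def)
    have "a \<otimes> d = (a \<otimes> inv a) \<otimes> (b \<otimes> a' \<oplus> b' \<otimes> \<sigma> a \<ominus> a' \<otimes> \<sigma> b)"
      unfolding d_def by (rule m_assoc[symmetric]) auto
    then have "b \<otimes> a' \<oplus> b' \<otimes> \<sigma> a = a \<otimes> d \<oplus> a' \<otimes> \<sigma> b"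
      by (simp add: a_minus_def a_assoc l_neg)
    then have "(b, d) \<in> carrier skew_dual" "y \<otimes>\<^bsub>skew_dual\<^esub> x = x \<otimes>\<^bsub>skew_dual\<^esub> (b, d)"
      by (simp_all add: xy skew_dual_def m_comm)
    then show ?thesis unfolding l_coset_def by blast
  qed
  show "y \<otimes>\<^bsub>skew_dual\<^esub> x \<in> carrier skew_dual #>\<^bsub>skew_dual\<^esub> y"
  proof (cases "b = \<zero>")
    case True
    then have "(\<sigma> a, \<zero>) \<in> carrier skew_dual" "y \<otimes>\<^bsub>skew_dual\<^esub> x = (\<sigma> a, \<zero>) \<otimes>\<^bsub>skew_dual\<^esub> y"
      by (simp_all add: xy skew_dual_def m_comm)
    then show ?thesis unfolding r_coset_def by blast
  next
    case False
    \<comment> \<open>The same on the other side: (a, d) y has linear coefficient a b' + d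
      \<sigma>(b).\<close>
    define d where "d = (b \<otimes> a' \<oplus> b' \<otimes> \<sigma> a \<ominus> a \<otimes> b') \<otimes> inv (\<sigma> b)"
    have [simp]: "d \<in> carrier R" "inv (\<sigma> b) \<in> carrier R" "inv (\<sigma> b) \<otimes> \<sigma> b = \<one>"
      using False field_Units by (auto simp: d_def)
    have "d \<otimes> \<sigma> b = (b \<otimes> a' \<oplus> b' \<otimes> \<sigma> a \<ominus> a \<otimes> b') \<otimes> (inv (\<sigma> b) \<otimes> \<sigma> b)"
      unfolding d_def by (rule m_assoc) auto
    moreover have "p \<oplus> (q \<ominus> p) = q" if "p \<in> carrier R" "q \<in> carrier R" for p q
      using that by (simp add: a_minus_def a_lcomm[of p q] r_neg)
    ultimately have "b \<otimes> a' \<oplus> b' \<otimes> \<sigma> a = a \<otimes> b' \<oplus> d \<otimes> \<sigma> b"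
      by simp
    then have "(a, d) \<in> carrier skew_dual" "y \<otimes>\<^bsub>skew_dual\<^esub> x = (a, d) \<otimes>\<^bsub>skew_dual\<^esub> y"
      by (simp_all add: xy skew_dual_def m_comm)
    then show ?thesis unfolding r_coset_def by blast
  qed
qed

text \<open>The pair (0, 1) is the variable, which commutes with a constant only if \<sigma> fixes
  it.\<close>

lemma noncommutative_skew_dual:
  assumes "c \<in> carrier R" "\<sigma> c \<noteq> c"
  shows "noncommutative_ring skew_dual"
  unfolding noncommutative_ring_iff
  using assms ring_skew_dual
  by (intro conjI bexI[of _ "(\<zero>, \<one>)"] bexI[of _ "(c, \<zero>)"]) (auto simp: skew_dual_def)

lemma order_skew_dual: "order skew_dual = (order R)\<^sup>2"
  by (simp add: order_def skew_dual_def card_cartesian_product power2_eq_square)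

end

text \<open>The universal property of \<open>skew_dual\<close>: a homomorphism out of it is given by
  one on the coefficients and a square-zero image \<open>s\<close> of the variable that obeys the
  same twist.\<close>

lemma (in skew_poly) skew_dual_hom:
  fixes S (structure)
  assumes S: "ring S" and \<iota>: "\<iota> \<in> ring_hom R S"
    and s: "s \<in> carrier S" "s \<otimes>\<^bsub>S\<^esub> s = \<zero>\<^bsub>S\<^esub>"
    and comm: "\<And>c. c \<in> carrier R \<Longrightarrow> s \<otimes>\<^bsub>S\<^esub> \<iota> c = \<iota> (\<sigma> c) \<otimes>\<^bsub>S\<^esub> s"
  shows "(\<lambda>(a, b). \<iota> a \<oplus>\<^bsub>S\<^esub> \<iota> b \<otimes>\<^bsub>S\<^esub> s) \<in> ring_hom skew_dual S"
proof (rule ring_hom_memI)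
  interpret S: ring S by (rule S)
  note \<iota>_simps [simp] = ring_hom_closed[OF \<iota>] ring_hom_mult[OF \<iota>] ring_hom_add[OF \<iota>] ring_hom_one[OF \<iota>]
    ring_hom_zero[OF \<iota> ring_axioms S] s(1)
  fix x y assume "x \<in> carrier skew_dual" "y \<in> carrier skew_dual"
  then obtain a a' b b' where xy: "x = (a, a')" "y = (b, b')"
    and [simp]: "a \<in> carrier R" "a' \<in> carrier R" "b \<in> carrier R" "b' \<in> carrier R"
    by (auto simp: skew_dual_def)
  have 1: "\<iota> a' \<otimes>\<^bsub>S\<^esub> s \<otimes>\<^bsub>S\<^esub> \<iota> b = \<iota> a' \<otimes>\<^bsub>S\<^esub> \<iota> (\<sigma> b) \<otimes>\<^bsub>S\<^esub> s"
    by (simp add: S.m_assoc comm)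
  \<comment> \<open>Moving the first \<open>s\<close> across the coefficient brings the two copies
    of \<open>s\<close> together, and their product is zero.\<close>
  have "\<iota> a' \<otimes>\<^bsub>S\<^esub> s \<otimes>\<^bsub>S\<^esub> (\<iota> b' \<otimes>\<^bsub>S\<^esub> s) = \<iota> a' \<otimes>\<^bsub>S\<^esub> (s \<otimes>\<^bsub>S\<^esub> \<iota> b') \<otimes>\<^bsub>S\<^esub> s"
    by (simp add: S.m_assoc)
  then have 2: "\<iota> a' \<otimes>\<^bsub>S\<^esub> s \<otimes>\<^bsub>S\<^esub> (\<iota> b' \<otimes>\<^bsub>S\<^esub> s) = \<zero>\<^bsub>S\<^esub>"
    by (simp add: comm S.m_assoc s)
  show "(\<lambda>(a, b). \<iota> a \<oplus>\<^bsub>S\<^esub> \<iota> b \<otimes>\<^bsub>S\<^esub> s) (x \<otimes>\<^bsub>skew_dual\<^esub> y) =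
    (\<lambda>(a, b). \<iota> a \<oplus>\<^bsub>S\<^esub> \<iota> b \<otimes>\<^bsub>S\<^esub> s) x \<otimes>\<^bsub>S\<^esub> (\<lambda>(a, b). \<iota> a \<oplus>\<^bsub>S\<^esub> \<iota> b \<otimes>\<^bsub>S\<^esub> s) y"
    by (simp add: xy skew_dual_def S.l_distr S.r_distr 1 2) (simp add: S.m_assoc S.a_ac)
  show "(\<lambda>(a, b). \<iota> a \<oplus>\<^bsub>S\<^esub> \<iota> b \<otimes>\<^bsub>S\<^esub> s) (x \<oplus>\<^bsub>skew_dual\<^esub> y) =
    (\<lambda>(a, b). \<iota> a \<oplus>\<^bsub>S\<^esub> \<iota> b \<otimes>\<^bsub>S\<^esub> s) x \<oplus>\<^bsub>S\<^esub> (\<lambda>(a, b). \<iota> a \<oplus>\<^bsub>S\<^esub> \<iota> b \<otimes>\<^bsub>S\<^esub> s) y"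
    by (simp add: xy skew_dual_def S.l_distr S.a_ac)
next
  interpret S: ring S by (rule S)
  fix x assume "x \<in> carrier skew_dual"
  then show "(\<lambda>(a, b). \<iota> a \<oplus>\<^bsub>S\<^esub> \<iota> b \<otimes>\<^bsub>S\<^esub> s) x \<in> carrier S"
    using ring_hom_closed[OF \<iota>] s by (auto simp: skew_dual_def)
next
  interpret S: ring S by (rule S)
  show "(\<lambda>(a, b). \<iota> a \<oplus>\<^bsub>S\<^esub> \<iota> b \<otimes>\<^bsub>S\<^esub> s) \<one>\<^bsub>skew_dual\<^esub> = \<one>\<^bsub>S\<^esub>"
    using ring_hom_one[OF \<iota>] ring_hom_zero[OF \<iota> ring_axioms S] s by (simp add: skew_dual_def)
qed

section \<open>Transfer along isomorphisms\<close>

lemma symmetric_ring_iso: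
  assumes "ring R" "R \<simeq> S" "symmetric_ring S"
  shows "symmetric_ring R"
proof -
  interpret R: ring R by fact
  interpret S: symmetric_ring S by fact
  obtain h where h: "h \<in> ring_iso R S" using assms by (auto simp: is_ring_iso_def)
  then have hom: "h \<in> ring_hom R S" and inj: "inj_on h (carrier R)"
    by (auto simp: ring_iso_def bij_betw_def)
  note [simp] = ring_hom_closed[OF hom] ring_hom_mult[OF hom] ring_hom_zero[OF hom R.ring_axioms S.ring_axioms]
  show ?thesis
  proof
    fix a b c assume [simp]: "a \<in> carrier R" "b \<in> carrier R" "c \<in> carrier R"
      and "a \<otimes>\<^bsub>R\<^esub> b \<otimes>\<^bsub>R\<^esub> c = \<zero>\<^bsub>R\<^esub>"
    then have "h (a \<otimes>\<^bsub>R\<^esub> b \<otimes>\<^bsub>R\<^esub> c) = \<zero>\<^bsub>S\<^esub>" by (simp del: ring_hom_mult)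
    then have "h b \<otimes>\<^bsub>S\<^esub> h a \<otimes>\<^bsub>S\<^esub> h c = \<zero>\<^bsub>S\<^esub>" using S.symmetric[of "h a" "h b" "h c"] by simp
    then have "h (b \<otimes>\<^bsub>R\<^esub> a \<otimes>\<^bsub>R\<^esub> c) = h \<zero>\<^bsub>R\<^esub>" by simp
    then show "b \<otimes>\<^bsub>R\<^esub> a \<otimes>\<^bsub>R\<^esub> c = \<zero>\<^bsub>R\<^esub>" by (rule inj_onD[OF inj]) auto
  qed
qed

lemma duo_ring_iso:
  assumes "ring R" "R \<simeq> S" "duo_ring S"
  shows "duo_ring R"
proof -
  interpret R: ring R by fact
  interpret S: duo_ring S by fact
  obtain h where h: "h \<in> ring_iso R S" using assms by (auto simp: is_ring_iso_def)
  then have hom: "h \<in> ring_hom R S" and inj: "inj_on h (carrier R)" and surj: "h ` carrier R = carrier S"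
    by (auto simp: ring_iso_def bij_betw_def)
  note [simp] = ring_hom_closed[OF hom] ring_hom_mult[OF hom]
  show ?thesis
  proof
    fix a b assume [simp]: "a \<in> carrier R" "b \<in> carrier R"
    obtain c where c: "c \<in> carrier R" "h b \<otimes>\<^bsub>S\<^esub> h a = h a \<otimes>\<^bsub>S\<^esub> h c"
      using S.right_duo[of "h a" "h b"] unfolding surj[symmetric] l_coset_def by auto
    then have "b \<otimes>\<^bsub>R\<^esub> a = a \<otimes>\<^bsub>R\<^esub> c" by (intro inj_onD[OF inj]) auto
    then show "b \<otimes>\<^bsub>R\<^esub> a \<in> a <#\<^bsub>R\<^esub> carrier R" using c by (auto simp: l_coset_def)
    obtain d where d: "d \<in> carrier R" "h b \<otimes>\<^bsub>S\<^esub> h a = h d \<otimes>\<^bsub>S\<^esub> h b"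
      using S.left_duo[of "h a" "h b"] unfolding surj[symmetric] r_coset_def by auto
    then have "b \<otimes>\<^bsub>R\<^esub> a = d \<otimes>\<^bsub>R\<^esub> b" by (intro inj_onD[OF inj]) auto
    then show "b \<otimes>\<^bsub>R\<^esub> a \<in> carrier R #>\<^bsub>R\<^esub> b" using d by (auto simp: r_coset_def)
  qed
qed

lemma noncommutative_ring_iso:
  assumes "ring R" "R \<simeq> S" "noncommutative_ring S"
  shows "noncommutative_ring R"
proof -
  obtain h where h: "h \<in> ring_iso R S" using assms by (auto simp: is_ring_iso_def)
  then have hom: "h \<in> ring_hom R S" and surj: "h ` carrier R = carrier S"
    by (auto simp: ring_iso_def bij_betw_def)
  obtain a b where ab: "a \<in> carrier R" "b \<in> carrier R" "h a \<otimes>\<^bsub>S\<^esub> h b \<noteq> h b \<otimes>\<^bsub>S\<^esub> h a"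
    using assms(3) unfolding noncommutative_ring_iff surj[symmetric] by blast
  then have "a \<otimes>\<^bsub>R\<^esub> b \<noteq> b \<otimes>\<^bsub>R\<^esub> a" using ring_hom_mult[OF hom] by metis
  then show ?thesis using ab assms(1) unfolding noncommutative_ring_iff by blast
qed

section \<open>The ring over the field with four elements\<close>

interpretation F4: skew_dual_field F4 frob_F4
  by (intro skew_dual_field.intro skew_dual_field_axioms.intro field_F4 frob_F4_iso)

lemma frob_F4_eq: "frob_F4 (a, b) = (a + b, b)"
proof -
  have "x \<in> carrier F4" for x by (simp add: F4_def)
  then have "frob_F4 x = x \<otimes>\<^bsub>F4\<^esub> x" for x
    by (simp add: frob_F4_def numeral_2_eq_2)
  then show ?thesis
    by (cases a; cases b) (simp_all add: F4_def)
qed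

lemma F4_skew_quot_iso: "F4_skew_quot \<simeq> F4.skew_dual"
  unfolding F4_skew_quot_def Let_def by (rule F4.skew_UP_Quot_iso)

lemma ring_F4_skew_quot: "ring F4_skew_quot"
  unfolding F4_skew_quot_def Let_def by (rule F4.ring_skew_UP_Quot)

lemma F4_skew_quot_properties:
  "symmetric_ring F4_skew_quot" "duo_ring F4_skew_quot" "noncommutative_ring F4_skew_quot"
  "order F4_skew_quot = 16"
proof -
  have "noncommutative_ring F4.skew_dual"
    by (rule F4.noncommutative_skew_dual[of "(0, 1)"]) (simp_all add: F4_def frob_F4_eq)
  then show "noncommutative_ring F4_skew_quot"
    by (rule noncommutative_ring_iso[OF ring_F4_skew_quot F4_skew_quot_iso])
  show "order F4_skew_quot = 16"
    using ring_iso_same_card[OF F4_skew_quot_iso] F4.order_skew_dual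
    by (simp add: order_F4) (simp add: order_def)
qed (rule symmetric_ring_iso duo_ring_iso; rule ring_F4_skew_quot F4_skew_quot_iso
    F4.symmetric_skew_dual F4.duo_skew_dual)+

text \<open>\<open>char2\<close> and \<open>ww\<close> are the relations of the four-element field,
  \<open>ss\<close> and \<open>sw\<close> those of the variable, so the universal property gives a
  homomorphism from \<open>F4.skew_dual\<close>. It is onto by \<open>gen\<close>, hence bijective
  because both rings have 16 elements.\<close>

lemma iso_F4_skew_quot:
  fixes R (structure)
  assumes R: "ring R" and w: "w \<in> carrier R" and s: "s \<in> carrier R"
    and char2: "\<one> \<oplus> \<one> = \<zero>" and ww: "w \<otimes> w = w \<oplus> \<one>"
    and ss: "s \<otimes> s = \<zero>" and sw: "s \<otimes> w = (w \<oplus> \<one>) \<otimes> s"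
    and gen: "\<And>x. x \<in> carrier R \<Longrightarrow>
      \<exists>a\<in>{\<zero>, \<one>, w, w \<oplus> \<one>}. \<exists>b\<in>{\<zero>, \<one>, w, w \<oplus> \<one>}. x = a \<oplus> b \<otimes> s"
    and order: "order R = 16"
  shows "R \<simeq> F4_skew_quot"
proof -
  interpret ring R by (rule R)
  note [simp] = w s
  have add_self: "x \<oplus> x = \<zero>" if "x \<in> carrier R" for x
    using that l_distr[of \<one> \<one> x] char2 by simp
  have add_self': "x \<oplus> (x \<oplus> y) = y" if "x \<in> carrier R" "y \<in> carrier R" for x y
    using that by (simp add: a_assoc[symmetric] add_self)
  \<comment> \<open>The element a + b \<omega> goes to a + b \<open>w\<close>, with the bits read as
    the coefficients 0 and 1 of \<open>R\<close>.\<close>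
  define \<iota> where "\<iota> = (\<lambda>(a :: bit, b :: bit). (if b = 1 then w else \<zero>) \<oplus> (if a = 1 then \<one> else \<zero>))"
  have "\<iota> \<in> ring_hom F4 R"
  proof (rule ring_hom_memI)
    fix x y :: "bit \<times> bit"
    obtain a b c d where xy: "x = (a, b)" "y = (c, d)" by (cases x; cases y)
    show "\<iota> x \<in> carrier R" by (simp add: xy \<iota>_def)
    show "\<iota> (x \<otimes>\<^bsub>F4\<^esub> y) = \<iota> x \<otimes> \<iota> y"
      by (cases a; cases b; cases c; cases d)
        (simp_all add: xy \<iota>_def F4_def l_distr r_distr ww add_self add_self' a_ac)
    show "\<iota> (x \<oplus>\<^bsub>F4\<^esub> y) = \<iota> x \<oplus> \<iota> y"
      by (cases a; cases b; cases c; cases d)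
        (simp_all add: xy \<iota>_def F4_def add_self add_self' a_ac)
  qed (simp add: F4_def \<iota>_def)
  moreover have "s \<otimes> \<iota> c = \<iota> (frob_F4 c) \<otimes> s" for c
    by (cases c; cases "fst c"; cases "snd c")
      (simp_all add: \<iota>_def frob_F4_eq sw r_distr l_distr a_assoc add_self)
  ultimately have hom: "(\<lambda>(a, b). \<iota> a \<oplus> \<iota> b \<otimes> s) \<in> ring_hom F4.skew_dual R"
    by (intro F4.skew_dual_hom R s ss)
  have rng: "{\<zero>, \<one>, w, w \<oplus> \<one>} \<subseteq> range \<iota>"
  proof -
    have "\<iota> (0, 0) = \<zero>" "\<iota> (1, 0) = \<one>" "\<iota> (0, 1) = w" "\<iota> (1, 1) = w \<oplus> \<one>"
      by (simp_all add: \<iota>_def)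
    then show ?thesis
      using rangeI[of \<iota> "(0, 0)"] rangeI[of \<iota> "(1, 0)"] rangeI[of \<iota> "(0, 1)"] rangeI[of \<iota> "(1, 1)"]
      by simp
  qed
  have "x \<in> (\<lambda>(a, b). \<iota> a \<oplus> \<iota> b \<otimes> s) ` carrier F4.skew_dual" if x: "x \<in> carrier R" for x
  proof -
    obtain a b where "x = \<iota> a \<oplus> \<iota> b \<otimes> s"
      using gen[OF x] subsetD[OF rng] by (elim bexE) (metis imageE)
    then show ?thesis by (intro image_eqI[of _ _ "(a, b)"]) (simp_all add: F4.skew_dual_def, simp add: F4_def)
  qed
  then have surj: "(\<lambda>(a, b). \<iota> a \<oplus> \<iota> b \<otimes> s) ` carrier F4.skew_dual = carrier R"
    using ring_hom_closed[OF hom] by blast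
  moreover have card: "card (carrier F4.skew_dual) = card (carrier R)"
    using F4.order_skew_dual order by (simp add: order_F4) (simp add: order_def)
  moreover have "finite (carrier F4.skew_dual)"
    using card order by (intro card_ge_0_finite) (simp add: order_def)
  ultimately have "bij_betw (\<lambda>(a, b). \<iota> a \<oplus> \<iota> b \<otimes> s) (carrier F4.skew_dual) (carrier R)"
    by (simp add: bij_betw_def eq_card_imp_inj_on)
  with hom have "F4.skew_dual \<simeq> R" by (auto simp: is_ring_iso_def ring_iso_def)
  then show ?thesis
    using ring_iso_trans[OF F4_skew_quot_iso] ring_iso_sym[OF ring_F4_skew_quot] by blast
qed

section \<open>Finite reversible rings\<close>

context ring
begin

lemma minus_eq_zero_iff: "x \<in> carrier R \<Longrightarrow> y \<in> carrier R \<Longrightarrow> x \<ominus> y = \<zero> \<longleftrightarrow> x = y"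
  by (metis a_minus_def add.inv_closed minus_equality minus_minus r_neg)

lemma r_distr_minus:
  "x \<in> carrier R \<Longrightarrow> y \<in> carrier R \<Longrightarrow> z \<in> carrier R \<Longrightarrow> x \<otimes> (y \<ominus> z) = x \<otimes> y \<ominus> x \<otimes> z"
  by (simp add: a_minus_def r_distr r_minus)

lemma l_distr_minus:
  "x \<in> carrier R \<Longrightarrow> y \<in> carrier R \<Longrightarrow> z \<in> carrier R \<Longrightarrow> (y \<ominus> z) \<otimes> x = y \<otimes> x \<ominus> z \<otimes> x"
  by (simp add: a_minus_def l_distr l_minus)

end

text \<open>Symmetry enters the classification as reversibility. This condition mentions only
  products and zero, so corners, which have a different unity, inherit it.\<close>

locale finite_reversible_ring = ring +
  assumes finite_carrier: "finite (carrier R)"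
    and reversible: "\<lbrakk>a \<in> carrier R; b \<in> carrier R; a \<otimes> b = \<zero>\<rbrakk> \<Longrightarrow> b \<otimes> a = \<zero>"
begin

text \<open>On one side 1 - e kills ex, and on the other it kills xe. Reversibility moves it to the
  opposite side in both cases, so ex and xe both equal exe.\<close>

lemma idempotent_central:
  assumes e: "e \<in> carrier R" "e \<otimes> e = e" and x: "x \<in> carrier R"
  shows "e \<otimes> x = x \<otimes> e"
proof -
  have "(\<one> \<ominus> e) \<otimes> (e \<otimes> x) = (e \<ominus> e \<otimes> e) \<otimes> x" using e(1) x by algebra
  then have "(\<one> \<ominus> e) \<otimes> (e \<otimes> x) = \<zero>" unfolding e(2) using e(1) x by (simp add: r_neg a_minus_def)
  then have "(e \<otimes> x) \<otimes> (\<one> \<ominus> e) = \<zero>"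
    using e x by (intro reversible[of "\<one> \<ominus> e" "e \<otimes> x"]) auto
  moreover have "(e \<otimes> x) \<otimes> (\<one> \<ominus> e) = e \<otimes> x \<ominus> e \<otimes> x \<otimes> e"
    using e(1) x by (simp add: a_minus_def r_distr r_minus)
  ultimately have 1: "e \<otimes> x = e \<otimes> x \<otimes> e" using e(1) x minus_eq_zero_iff by simp
  have "(x \<otimes> e) \<otimes> (\<one> \<ominus> e) = x \<otimes> (e \<ominus> e \<otimes> e)"
    using e(1) x by (simp add: a_minus_def r_distr r_minus m_assoc)
  then have "(x \<otimes> e) \<otimes> (\<one> \<ominus> e) = \<zero>" unfolding e(2) using e(1) x by (simp add: r_neg a_minus_def)
  then have "(\<one> \<ominus> e) \<otimes> (x \<otimes> e) = \<zero>"
    using e x by (intro reversible[of "x \<otimes> e" "\<one> \<ominus> e"]) auto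
  moreover have "(\<one> \<ominus> e) \<otimes> (x \<otimes> e) = x \<otimes> e \<ominus> e \<otimes> x \<otimes> e"
    using e(1) x by (simp add: a_minus_def l_distr l_minus m_assoc)
  ultimately have "x \<otimes> e = e \<otimes> x \<otimes> e" using e(1) x minus_eq_zero_iff by simp
  with 1 show ?thesis by simp
qed

text \<open>From xy = 1 follows (yx - 1)y = 0. Reversibility puts y in front, and multiplying by x
  on the left cancels it.\<close>

lemma inverse_commutes:
  assumes "x \<in> carrier R" "y \<in> carrier R" "x \<otimes> y = \<one>"
  shows "y \<otimes> x = \<one>"
proof -
  have "(y \<otimes> x \<ominus> \<one>) \<otimes> y = y \<otimes> (x \<otimes> y) \<ominus> y" using assms(1,2) by algebra
  then have "y \<otimes> (y \<otimes> x \<ominus> \<one>) = \<zero>"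
    using assms by (intro reversible[of "y \<otimes> x \<ominus> \<one>" y]) (simp_all add: r_neg a_minus_def)
  moreover have "x \<otimes> (y \<otimes> (y \<otimes> x \<ominus> \<one>)) = (x \<otimes> y) \<otimes> (y \<otimes> x) \<ominus> (x \<otimes> y)"
    using assms(1,2) by (simp add: a_minus_def r_distr r_minus m_assoc)
  ultimately have "y \<otimes> x \<ominus> \<one> = \<zero>" using assms by simp
  then show ?thesis using assms minus_eq_zero_iff by simp
qed

text \<open>By the pigeonhole principle the powers of x are periodic with some period
  \<open>p\<close> from some exponent \<open>i\<close> on. An exponent that is a multiple of
  \<open>p\<close> and at least \<open>i\<close> then gives an idempotent.\<close>

lemma power_idempotent:
  assumes x: "x \<in> carrier R"
  shows "\<exists>n>0. x [^] n \<otimes> x [^] n = x [^] (n::nat)"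
proof -
  have "\<not> inj (\<lambda>n::nat. x [^] n)"
  proof
    assume "inj (\<lambda>n::nat. x [^] n)"
    then have "infinite (range (\<lambda>n::nat. x [^] n))" using finite_imageD infinite_UNIV_nat by blast
    moreover have "range (\<lambda>n::nat. x [^] n) \<subseteq> carrier R" using x by auto
    ultimately show False using finite_carrier finite_subset by blast
  qed
  then obtain i j :: nat where "i < j" "x [^] i = x [^] j"
    unfolding inj_def by (metis linorder_neqE_nat)
  then obtain p where p: "p > 0" and ip: "x [^] i = x [^] (i + p)"
    by (metis less_imp_add_positive)
  have 1: "x [^] (i + p + k) = x [^] (i + k)" for k
    using x ip by (simp add: nat_pow_mult[symmetric])
  have 2: "x [^] (i + k + m * p) = x [^] (i + k)" for k m
  proof (induction m)
    case (Suc m)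
    have "x [^] (i + k + Suc m * p) = x [^] (i + p + (k + m * p))" by (simp add: algebra_simps)
    also have "\<dots> = x [^] (i + k + m * p)" unfolding 1 by (simp add: algebra_simps)
    finally show ?case using Suc by simp
  qed simp
  define n where "n = Suc i * p"
  have "i \<le> n" using p unfolding n_def by (cases p) auto
  then obtain k where k: "n = i + k" using le_Suc_ex by blast
  have "x [^] n \<otimes> x [^] n = x [^] (n + n)" using x by (rule nat_pow_mult)
  also have "n + n = i + k + Suc i * p" using k n_def by simp
  also have "x [^] (i + k + Suc i * p) = x [^] (i + k)" by (rule 2)
  also have "\<dots> = x [^] n" unfolding k ..
  finally show ?thesis using p n_def by (intro exI[of _ n]) auto
qed

end

section \<open>Local rings and their ideal of nonunits\<close>

locale finite_reversible_local_ring = finite_reversible_ring +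
  assumes one_not_zero: "\<one> \<noteq> \<zero>"
    and idempotents: "\<lbrakk>e \<in> carrier R; e \<otimes> e = e\<rbrakk> \<Longrightarrow> e = \<zero> \<or> e = \<one>"
begin

text \<open>This is the ideal N of the overview. Triviality of the idempotents is the assumption
  from which the lemmas below derive that it is a nil ideal.\<close>

definition nonunits where "nonunits = carrier R - Units R"

lemma nonunits_closed [simp]: "x \<in> nonunits \<Longrightarrow> x \<in> carrier R"
  by (simp add: nonunits_def)

text \<open>Some power with positive exponent is idempotent, hence 0 or 1, and the value 1 would
  make x invertible.\<close>

lemma nonunits_nilpotent:
  assumes "x \<in> nonunits"
  shows "\<exists>n. x [^] (n::nat) = \<zero>"
proof -
  have x: "x \<in> carrier R" using assms by simp
  obtain n :: nat where n: "n > 0" "x [^] n \<otimes> x [^] n = x [^] n" using power_idempotent[OF x] by blast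
  have "x [^] n \<noteq> \<one>"
  proof
    assume one: "x [^] n = \<one>"
    obtain m where "n = Suc m" using n by (cases n) auto
    then have "x [^] m \<otimes> x = \<one>" using one by simp
    then have "x \<in> Units R"
      using x inverse_commutes[of "x [^] m" x] by (auto simp: Units_def)
    then show False using assms by (simp add: nonunits_def)
  qed
  then show ?thesis using idempotents[of "x [^] n"] n x by auto
qed

text \<open>If a product with x is a unit, then x has an inverse on one side, which
  \<open>inverse_commutes\<close> makes two-sided.\<close>

lemma nonunits_mult:
  assumes "x \<in> nonunits" "r \<in> carrier R"
  shows "r \<otimes> x \<in> nonunits" "x \<otimes> r \<in> nonunits"
proof -
  have x: "x \<in> carrier R" "x \<notin> Units R" using assms by (auto simp: nonunits_def)
  have left: "x \<in> Units R" if "y \<in> carrier R" "y \<otimes> x = \<one>" for y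
    using inverse_commutes[of y x] that x by (auto simp: Units_def)
  have right: "x \<in> Units R" if "y \<in> carrier R" "x \<otimes> y = \<one>" for y
    using inverse_commutes[of x y] that x by (auto simp: Units_def)
  have "r \<otimes> x \<notin> Units R"
  proof
    assume u: "r \<otimes> x \<in> Units R"
    have "(inv (r \<otimes> x) \<otimes> r) \<otimes> x = inv (r \<otimes> x) \<otimes> (r \<otimes> x)" using x assms u by (intro m_assoc) auto
    then show False using left[of "inv (r \<otimes> x) \<otimes> r"] x assms u by auto
  qed
  moreover have "x \<otimes> r \<notin> Units R"
  proof
    assume u: "x \<otimes> r \<in> Units R"
    have "x \<otimes> (r \<otimes> inv (x \<otimes> r)) = (x \<otimes> r) \<otimes> inv (x \<otimes> r)" using x assms u by (intro m_assoc[symmetric]) auto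
    then show False using right[of "r \<otimes> inv (x \<otimes> r)"] x assms u by auto
  qed
  ultimately show "r \<otimes> x \<in> nonunits" "x \<otimes> r \<in> nonunits" using x assms by (auto simp: nonunits_def)
qed

lemma zero_nonunit [simp]: "\<zero> \<in> nonunits"
proof -
  have "\<zero> \<notin> Units R" using one_not_zero Units_r_inv_ex[of \<zero>] by (metis l_null)
  then show ?thesis by (simp add: nonunits_def)
qed

lemma one_not_nonunit [simp]: "\<one> \<notin> nonunits"
  by (simp add: nonunits_def)

text \<open>Right multiplication by 1 - p fixes the last nonzero power of p. Hence so do all powers
  of 1 - p, and none of them can be zero.\<close>

lemma one_minus_nonunit:
  assumes "p \<in> nonunits"
  shows "\<one> \<ominus> p \<notin> nonunits"
proof
  assume q: "\<one> \<ominus> p \<in> nonunits"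
  have p: "p \<in> carrier R" using assms by simp
  define n where "n = (LEAST n::nat. p [^] n = \<zero>)"
  have n: "p [^] n = \<zero>"
    unfolding n_def using nonunits_nilpotent[OF assms] by (rule LeastI_ex)
  then have "n \<noteq> 0" using one_not_zero by (cases n) auto
  then obtain m where m: "n = Suc m" by (cases n) auto
  have pm: "p [^] m \<noteq> \<zero>" using not_less_Least[of m "\<lambda>n. p [^] n = \<zero>"] m n_def by simp
  have "p [^] m \<otimes> (\<one> \<ominus> p) = p [^] m \<ominus> p [^] m \<otimes> p" using p by (simp add: a_minus_def r_distr r_minus)
  then have pm1: "p [^] m \<otimes> (\<one> \<ominus> p) = p [^] m" using n m p by (simp add: a_minus_def)
  have "p [^] m \<otimes> (\<one> \<ominus> p) [^] k = p [^] m" for k :: nat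
  proof (induction k)
    case (Suc k)
    have "p [^] m \<otimes> (\<one> \<ominus> p) [^] Suc k = (p [^] m \<otimes> (\<one> \<ominus> p) [^] k) \<otimes> (\<one> \<ominus> p)"
      using p by (simp add: m_assoc)
    then show ?case using Suc pm1 by simp
  qed (use p in simp)
  moreover obtain k :: nat where "(\<one> \<ominus> p) [^] k = \<zero>" using nonunits_nilpotent[OF q] by blast
  ultimately show False using pm p by (metis nat_pow_closed r_null)
qed

text \<open>If x + y had an inverse v, then vx and vy would be nonunits with sum 1.\<close>

lemma nonunits_add:
  assumes "x \<in> nonunits" "y \<in> nonunits"
  shows "x \<oplus> y \<in> nonunits"
proof (rule ccontr)
  assume "x \<oplus> y \<notin> nonunits"
  then have u: "x \<oplus> y \<in> Units R" using assms by (simp add: nonunits_def)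
  define v where "v = inv (x \<oplus> y)"
  have v: "v \<in> carrier R" "v \<otimes> (x \<oplus> y) = \<one>" using u by (auto simp: v_def)
  have "v \<otimes> y = v \<otimes> (x \<oplus> y) \<ominus> v \<otimes> x" using assms v(1) nonunits_closed by algebra
  moreover have "v \<otimes> x \<in> nonunits" "v \<otimes> y \<in> nonunits" using assms v nonunits_mult(1) by auto
  ultimately show False using v one_minus_nonunit[of "v \<otimes> x"] by simp
qed

lemma nonunits_minus:
  assumes "x \<in> nonunits" "y \<in> nonunits"
  shows "x \<ominus> y \<in> nonunits"
proof -
  have "x \<ominus> y = x \<oplus> (\<ominus> \<one>) \<otimes> y" using assms nonunits_closed by algebra
  then show ?thesis using assms nonunits_add nonunits_mult by simp
qed

lemma mult_nonunitD:
  assumes "x \<in> carrier R" "y \<in> carrier R" "x \<otimes> y \<in> nonunits"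
  shows "x \<in> nonunits \<or> y \<in> nonunits"
  using assms Units_m_closed by (auto simp: nonunits_def)

lemma unit_mult_eq_zero:
  assumes "x \<in> carrier R" "x \<notin> nonunits" "y \<in> carrier R"
  shows "x \<otimes> y = \<zero> \<Longrightarrow> y = \<zero>" "y \<otimes> x = \<zero> \<Longrightarrow> y = \<zero>"
proof -
  have x: "x \<in> Units R" using assms by (simp add: nonunits_def)
  show 1: "y = \<zero>" if "x \<otimes> y = \<zero>"
    using Units_l_cancel[OF x assms(3) zero_closed] that assms(1) by simp
  show "y = \<zero>" if "y \<otimes> x = \<zero>"
    using 1 reversible[OF assms(3,1) that] .
qed

text \<open>A nonunit \<open>s \<noteq> 0\<close> with the largest annihilator will do: if \<open>s c \<noteq> 0\<close>, then \<open>s c\<close> and \<open>s\<close> have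
  the same annihilator, so no power of \<open>c\<close> annihilates \<open>s\<close>.\<close>

lemma socle_element:
  assumes "nonunits \<noteq> {\<zero>}"
  obtains s where "s \<in> nonunits" "s \<noteq> \<zero>"
    "\<forall>x\<in>nonunits. s \<otimes> x = \<zero> \<and> x \<otimes> s = \<zero>"
proof -
  define ann where "ann s = {y \<in> carrier R. y \<otimes> s = \<zero>}" for s
  have fin: "finite (ann s)" for s using finite_carrier by (simp add: ann_def)
  obtain s0 where "s0 \<in> nonunits \<and> s0 \<noteq> \<zero>" using assms zero_nonunit by blast
  \<comment> \<open>The bound is a successor because \<open>ex_has_greatest_nat\<close> asks for a
    strict one.\<close>
  moreover have "\<forall>t. t \<in> nonunits \<and> t \<noteq> \<zero> \<longrightarrow> card (ann t) < Suc (card (carrier R))"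
    using card_mono[OF finite_carrier] by (auto simp: ann_def less_Suc_eq_le)
  ultimately obtain s where s: "s \<in> nonunits" "s \<noteq> \<zero>"
    and max: "\<And>t. t \<in> nonunits \<Longrightarrow> t \<noteq> \<zero> \<Longrightarrow> card (ann t) \<le> card (ann s)"
    using ex_has_greatest_nat[of "\<lambda>t. t \<in> nonunits \<and> t \<noteq> \<zero>" s0 "\<lambda>t. card (ann t)" "Suc (card (carrier R))"] by metis
  have sc [simp]: "s \<in> carrier R" using s by simp
  have left: "s \<otimes> c = \<zero>" if c: "c \<in> nonunits" for c
  proof (rule ccontr)
    assume nz: "s \<otimes> c \<noteq> \<zero>"
    have cc [simp]: "c \<in> carrier R" using c by simp
    have "ann s \<subseteq> ann (s \<otimes> c)" by (auto simp: ann_def simp flip: m_assoc)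
    moreover have "card (ann (s \<otimes> c)) \<le> card (ann s)"
      using s c nz nonunits_mult by (intro max) auto
    ultimately have eq: "ann (s \<otimes> c) = ann s" using fin card_seteq by metis
    have "c [^] k \<otimes> s \<noteq> \<zero>" for k :: nat
    proof (induction k)
      case (Suc k)
      show ?case
      proof
        assume "c [^] Suc k \<otimes> s = \<zero>"
        then have "c \<otimes> (c [^] k \<otimes> s) = \<zero>"
          unfolding nat_pow_Suc2[OF cc] by (simp add: m_assoc)
        \<comment> \<open>Reversibility moves the leading \<open>c\<close> to the end, where it
          meets \<open>s\<close>.\<close>
        then have "c [^] k \<otimes> (s \<otimes> c) = \<zero>"
          using reversible[of c "c [^] k \<otimes> s"] by (simp add: m_assoc)
        then have "c [^] k \<in> ann (s \<otimes> c)" by (simp add: ann_def)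
        then show False unfolding eq using Suc by (simp add: ann_def)
      qed
    qed (use s in simp)
    moreover obtain k :: nat where "c [^] k = \<zero>" using nonunits_nilpotent[OF c] by blast
    ultimately show False by (metis l_null sc)
  qed
  show ?thesis
    using that[OF s] left reversible[OF sc nonunits_closed left] by blast
qed

lemma minus_nonunit_commute:
  assumes "x \<in> carrier R" "y \<in> carrier R"
  shows "x \<ominus> y \<in> nonunits \<longleftrightarrow> y \<ominus> x \<in> nonunits"
proof -
  have "y \<ominus> x \<in> nonunits" if "x \<ominus> y \<in> nonunits" "x \<in> carrier R" "y \<in> carrier R" for x y
  proof -
    have "y \<ominus> x = \<zero> \<ominus> (x \<ominus> y)" using that(2,3) by algebra
    then show ?thesis using nonunits_minus[OF zero_nonunit that(1)] by simp
  qed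
  then show ?thesis using assms by blast
qed

section \<open>Division rings of order at most 16\<close>

text \<open>The centralizer \<open>C\<close> of x has at most four elements because the square of
  its size is at most 16. It contains 0, 1, x and x + 1, so these exhaust it, and x^2, which also
  lies in \<open>C\<close>, can only be x + 1.\<close>

lemma division_noncommuting_square:
  assumes div: "nonunits = {\<zero>}" and order: "order R \<le> 16"
    and xy: "x \<in> carrier R" "y \<in> carrier R" "x \<otimes> y \<noteq> y \<otimes> x"
  shows "x \<otimes> x = x \<oplus> \<one>"
proof -
  define C where "C = {z \<in> carrier R. z \<otimes> x = x \<otimes> z}"
  have C_closed: "z \<in> carrier R" if "z \<in> C" for z using that by (simp add: C_def)
  \<comment> \<open>If \<open>v y \<in> C\<close> with \<open>v \<in> C\<close>, then \<open>v (y x - x y) = 0\<close>, so \<open>v = 0\<close>; hence \<open>|C|\<^sup>2 \<le> |R|\<close>.\<close>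
  have "inj_on (\<lambda>(u, v). u \<oplus> v \<otimes> y) (C \<times> C)"
  proof (rule inj_onI, clarify)
    fix u v u' v' assume C: "u \<in> C" "v \<in> C" "u' \<in> C" "v' \<in> C"
      and eq: "u \<oplus> v \<otimes> y = u' \<oplus> v' \<otimes> y"
    note [simp] = C[THEN C_closed] xy(1,2)
    have comm: "u \<otimes> x = x \<otimes> u" "v \<otimes> x = x \<otimes> v" "u' \<otimes> x = x \<otimes> u'" "v' \<otimes> x = x \<otimes> v'"
      using C by (auto simp: C_def)
    have "(v \<ominus> v') \<otimes> y = (u \<oplus> v \<otimes> y) \<ominus> v' \<otimes> y \<ominus> u"
      using C_closed[OF C(1)] C_closed[OF C(2)] C_closed[OF C(4)] xy(2) by algebra
    also have "\<dots> = u' \<ominus> u"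
      unfolding eq using C_closed[OF C(1)] C_closed[OF C(3)] C_closed[OF C(4)] xy(2) by algebra
    finally have d: "(v \<ominus> v') \<otimes> y = u' \<ominus> u" .
    have "(v \<ominus> v') \<otimes> (y \<otimes> x) = ((v \<ominus> v') \<otimes> y) \<otimes> x" by (simp add: m_assoc)
    also have "\<dots> = x \<otimes> ((v \<ominus> v') \<otimes> y)"
      unfolding d by (simp add: a_minus_def l_distr r_distr l_minus r_minus comm)
    also have "\<dots> = (x \<otimes> (v \<ominus> v')) \<otimes> y" by (simp add: m_assoc)
    also have "x \<otimes> (v \<ominus> v') = (v \<ominus> v') \<otimes> x"
      by (simp add: a_minus_def l_distr r_distr l_minus r_minus comm)
    also have "(v \<ominus> v') \<otimes> x \<otimes> y = (v \<ominus> v') \<otimes> (x \<otimes> y)" by (simp add: m_assoc)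
    finally have "(v \<ominus> v') \<otimes> (y \<otimes> x \<ominus> x \<otimes> y) = \<zero>"
      by (simp add: r_distr_minus minus_eq_zero_iff)
    then have "v \<ominus> v' \<in> nonunits"
      using unit_mult_eq_zero(1)[of "v \<ominus> v'" "y \<otimes> x \<ominus> x \<otimes> y"] xy(3) minus_eq_zero_iff[of "y \<otimes> x" "x \<otimes> y"]
      by auto
    then have "v = v'" using div minus_eq_zero_iff by simp
    then show "u = u' \<and> v = v'" using eq by simp
  qed
  moreover have "(\<lambda>(u, v). u \<oplus> v \<otimes> y) ` (C \<times> C) \<subseteq> carrier R"
    using C_closed xy(2) by auto
  ultimately have "card (C \<times> C) \<le> order R"
    unfolding order_def using finite_carrier by (rule card_inj_on_le)
  then have "card C * card C \<le> 16" using order by (simp add: card_cartesian_product)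
  \<comment> \<open>Five elements would already give 25 pairs.\<close>
  then have cardC: "card C \<le> 4"
    using mult_le_mono[of 5 "card C" 5 "card C"] by linarith
  \<comment> \<open>The excluded values 0, 1 and -1 of x all commute with y.\<close>
  have nz: "x \<noteq> \<zero>" "x \<noteq> \<one>" "x \<oplus> \<one> \<noteq> \<zero>"
  proof -
    show "x \<noteq> \<zero>" "x \<noteq> \<one>" using xy by auto
    show "x \<oplus> \<one> \<noteq> \<zero>"
    proof
      assume "x \<oplus> \<one> = \<zero>"
      then have "x = \<ominus> \<one>" using xy(1) minus_equality by fastforce
      then show False using xy by (simp add: l_minus r_minus)
    qed
  qed
  have "{\<zero>, \<one>, x, x \<oplus> \<one>} \<subseteq> C"
    using xy(1) by (auto simp: C_def l_distr r_distr)
  moreover have "card {\<zero>, \<one>, x, x \<oplus> \<one>} = 4"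
    using nz one_not_zero xy(1) by auto
  moreover have "finite C" using finite_carrier by (simp add: C_def)
  ultimately have "C = {\<zero>, \<one>, x, x \<oplus> \<one>}" using cardC by (metis card_seteq)
  moreover have "x \<otimes> x \<in> C" using xy(1) by (simp add: C_def m_assoc)
  moreover have unit: "z \<notin> nonunits" if "z \<noteq> \<zero>" for z using that div by simp
  have "x \<otimes> x \<noteq> \<zero>" using unit_mult_eq_zero(1)[of x x] unit nz xy(1) by auto
  moreover have "x \<otimes> x \<noteq> x"
    using idempotents[OF xy(1)] nz by auto
  moreover have "x \<otimes> x \<noteq> \<one>"
  proof
    assume "x \<otimes> x = \<one>"
    moreover have "(x \<ominus> \<one>) \<otimes> (x \<oplus> \<one>) = x \<otimes> x \<oplus> x \<ominus> (x \<oplus> \<one>)"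
      using xy(1) by (subst l_distr_minus) (simp_all add: r_distr)
    moreover have "x \<otimes> x \<oplus> x \<ominus> (x \<oplus> \<one>) = x \<otimes> x \<ominus> \<one>" using xy(1) by algebra
    ultimately have "(x \<ominus> \<one>) \<otimes> (x \<oplus> \<one>) = \<zero>" using minus_eq_zero_iff by simp
    then show False
      using unit_mult_eq_zero(1)[of "x \<ominus> \<one>" "x \<oplus> \<one>"] unit nz xy(1) minus_eq_zero_iff by auto
  qed
  ultimately show ?thesis by auto
qed

text \<open>Applying the square law to x, y and x + y gives xy + yx + 1 = 0 for every noncommuting
  pair. For the pair (a, ab) this reads a(ab) + aba + 1 = 0, while a times the relation for (a, b)
  is a(ab) + aba + a = 0. Hence a = 1, which commutes with b.\<close>

lemma division_commutative:
  assumes div: "nonunits = {\<zero>}" and order: "order R \<le> 16"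
    and "a \<in> carrier R" "b \<in> carrier R"
  shows "a \<otimes> b = b \<otimes> a"
proof (rule ccontr)
  assume nc: "a \<otimes> b \<noteq> b \<otimes> a"
  \<comment> \<open>Contradictory for the pairs \<open>(a, b)\<close> and \<open>(a, ab)\<close>.\<close>
  have P: "x \<otimes> y \<oplus> y \<otimes> x \<oplus> \<one> = \<zero>"
    if xy: "x \<in> carrier R" "y \<in> carrier R" "x \<otimes> y \<noteq> y \<otimes> x" for x y
  proof -
    note [simp] = xy(1,2)
    note sq = division_noncommuting_square[OF div order]
    have xx: "x \<otimes> x = x \<oplus> \<one>" using sq xy by metis
    have yy: "y \<otimes> y = y \<oplus> \<one>" using sq[of y x] xy by metis
    have "(x \<oplus> y) \<otimes> y \<noteq> y \<otimes> (x \<oplus> y)" using xy(3) by (simp add: l_distr r_distr)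
    then have "(x \<oplus> y) \<otimes> (x \<oplus> y) = x \<oplus> y \<oplus> \<one>" by (intro sq[of _ y]) auto
    moreover have "(x \<oplus> y) \<otimes> (x \<oplus> y) = x \<otimes> x \<oplus> y \<otimes> y \<oplus> (x \<otimes> y \<oplus> y \<otimes> x)"
      using xy(1,2) by algebra
    moreover have "x \<oplus> \<one> \<oplus> (y \<oplus> \<one>) \<oplus> (x \<otimes> y \<oplus> y \<otimes> x) =
      x \<oplus> y \<oplus> \<one> \<oplus> (x \<otimes> y \<oplus> y \<otimes> x \<oplus> \<one>)"
      using xy(1,2) by algebra
    ultimately have "x \<oplus> y \<oplus> \<one> \<oplus> (x \<otimes> y \<oplus> y \<otimes> x \<oplus> \<one>) = x \<oplus> y \<oplus> \<one>" by (simp add: xx yy)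
    then show ?thesis by (simp del: l_zero r_zero)
  qed
  note [simp] = assms(3,4)
  have az: "a \<noteq> \<zero>" using nc by auto
  have 1: "a \<otimes> b \<oplus> b \<otimes> a \<oplus> \<one> = \<zero>" by (rule P) (use nc in auto)
  have "a \<otimes> (a \<otimes> b) \<noteq> a \<otimes> b \<otimes> a"
  proof
    assume "a \<otimes> (a \<otimes> b) = a \<otimes> b \<otimes> a"
    then have "a \<otimes> (a \<otimes> b \<ominus> b \<otimes> a) = \<zero>"
      by (simp add: a_minus_def r_distr r_minus m_assoc r_neg)
    then show False
      using unit_mult_eq_zero(1)[of a "a \<otimes> b \<ominus> b \<otimes> a"] div az nc minus_eq_zero_iff by auto
  qed
  then have 2: "a \<otimes> (a \<otimes> b) \<oplus> a \<otimes> b \<otimes> a \<oplus> \<one> = \<zero>" by (intro P) auto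
  have "a \<oplus> (a \<otimes> (a \<otimes> b) \<oplus> a \<otimes> b \<otimes> a) = a \<otimes> (a \<otimes> b \<oplus> b \<otimes> a \<oplus> \<one>)"
    by (simp add: r_distr m_assoc a_ac)
  also have "\<dots> = \<one> \<oplus> (a \<otimes> (a \<otimes> b) \<oplus> a \<otimes> b \<otimes> a)"
    unfolding 1 using 2 by (simp add: a_comm)
  finally have "a = \<one>" by (subst (asm) add.right_cancel) auto
  then show False using nc by auto
qed

section \<open>Commutativity of a small ideal of nonunits\<close>

text \<open>Adding \<open>s\<close> does not affect commuting with a or b, as \<open>s\<close>
  annihilates both. The cosets of {0, s} at 0, a, b and a + b are told apart by whether their
  elements commute with a and with b, so they supply eight distinct nonunits.\<close>

lemma nonunits_eight:
  assumes s: "s \<in> nonunits" "s \<noteq> \<zero>"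
    and ann: "\<forall>x\<in>nonunits. s \<otimes> x = \<zero> \<and> x \<otimes> s = \<zero>"
    and card: "card nonunits \<le> 8"
    and ab: "a \<in> nonunits" "b \<in> nonunits" "a \<otimes> b \<noteq> b \<otimes> a"
  shows "nonunits = {\<zero>, s} \<union> {a, a \<oplus> s} \<union> ({b, b \<oplus> s} \<union> {a \<oplus> b, a \<oplus> b \<oplus> s})"
    and "{\<zero>, s} \<union> {a, a \<oplus> s} \<subseteq> {x. x \<otimes> a = a \<otimes> x}"
    and "{b, b \<oplus> s} \<union> {a \<oplus> b, a \<oplus> b \<oplus> s} \<subseteq> {x. x \<otimes> a \<noteq> a \<otimes> x}"
    and "{a, a \<oplus> s} \<subseteq> {x. x \<otimes> b \<noteq> b \<otimes> x}"
proof -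
  note [simp] = nonunits_closed[OF s(1)] nonunits_closed[OF ab(1)] nonunits_closed[OF ab(2)]
    ann[rule_format, OF ab(1)] ann[rule_format, OF ab(2)] ab(3) ab(3)[symmetric]
  show 1: "{\<zero>, s} \<union> {a, a \<oplus> s} \<subseteq> {x. x \<otimes> a = a \<otimes> x}"
    and 2: "{b, b \<oplus> s} \<union> {a \<oplus> b, a \<oplus> b \<oplus> s} \<subseteq> {x. x \<otimes> a \<noteq> a \<otimes> x}"
    and 3: "{a, a \<oplus> s} \<subseteq> {x. x \<otimes> b \<noteq> b \<otimes> x}"
    by (auto simp: l_distr r_distr)
  have 4: "{\<zero>, s} \<union> {b, b \<oplus> s} \<subseteq> {x. x \<otimes> b = b \<otimes> x}"
    and 5: "{a \<oplus> b, a \<oplus> b \<oplus> s} \<subseteq> {x. x \<otimes> b \<noteq> b \<otimes> x}"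
    by (auto simp: l_distr r_distr)
  have two: "card {x, x \<oplus> s} = 2" if "x \<in> carrier R" for x
    using that s by simp
  have "({\<zero>, s} \<union> {a, a \<oplus> s}) \<inter> ({b, b \<oplus> s} \<union> {a \<oplus> b, a \<oplus> b \<oplus> s}) = {}"
    using 1 2 by blast
  moreover have "{\<zero>, s} \<inter> {a, a \<oplus> s} = {}" using 3 4 by blast
  then have "card ({\<zero>, s} \<union> {a, a \<oplus> s}) = 4"
    using two[of \<zero>] two[of a] card_Un_disjoint[of "{\<zero>, s}" "{a, a \<oplus> s}"] by simp
  moreover have "{b, b \<oplus> s} \<inter> {a \<oplus> b, a \<oplus> b \<oplus> s} = {}" using 4 5 by blast
  then have "card ({b, b \<oplus> s} \<union> {a \<oplus> b, a \<oplus> b \<oplus> s}) = 4"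
    using two[of b] two[of "a \<oplus> b"] card_Un_disjoint[of "{b, b \<oplus> s}" "{a \<oplus> b, a \<oplus> b \<oplus> s}"] by simp
  ultimately have "card ({\<zero>, s} \<union> {a, a \<oplus> s} \<union> ({b, b \<oplus> s} \<union> {a \<oplus> b, a \<oplus> b \<oplus> s})) = 8"
    by (subst card_Un_disjoint) simp_all
  moreover have "{\<zero>, s} \<union> {a, a \<oplus> s} \<union> ({b, b \<oplus> s} \<union> {a \<oplus> b, a \<oplus> b \<oplus> s}) \<subseteq> nonunits"
    using s ab nonunits_add by simp
  moreover have "finite nonunits" using finite_carrier by (simp add: nonunits_def)
  ultimately show "nonunits = {\<zero>, s} \<union> {a, a \<oplus> s} \<union> ({b, b \<oplus> s} \<union> {a \<oplus> b, a \<oplus> b \<oplus> s})"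
    using card card_seteq by metis
qed

lemma nonunits_commute:
  assumes card: "card nonunits \<le> 8" and ab: "a \<in> nonunits" "b \<in> nonunits"
  shows "a \<otimes> b = b \<otimes> a"
proof (rule ccontr)
  assume nc: "a \<otimes> b \<noteq> b \<otimes> a"
  have "nonunits \<noteq> {\<zero>}" using ab nc by auto
  then obtain s where s: "s \<in> nonunits" "s \<noteq> \<zero>"
    and ann: "\<forall>x\<in>nonunits. s \<otimes> x = \<zero> \<and> x \<otimes> s = \<zero>"
    by (rule socle_element) blast
  note eight = nonunits_eight[OF s ann card]
  \<comment> \<open>The square commutes with x, so apart from 0 and \<open>s\<close> it could only
    be x or x + s. In that case x^2 (1 - x) = 0 with 1 - x a unit.\<close>
  have sq: "x \<otimes> x = \<zero> \<or> x \<otimes> x = s"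
    if xy: "x \<in> nonunits" "y \<in> nonunits" "x \<otimes> y \<noteq> y \<otimes> x" for x y
  proof (rule ccontr)
    assume not: "\<not> ?thesis"
    note [simp] = nonunits_closed[OF s(1)] nonunits_closed[OF xy(1)] nonunits_closed[OF xy(2)]
      ann[rule_format, OF xy(1)] ann[rule_format, OF xy(2)]
    have "x \<otimes> x \<in> nonunits" using xy nonunits_mult by simp
    moreover have "x \<otimes> x \<otimes> x = x \<otimes> (x \<otimes> x)" by (simp add: m_assoc)
    ultimately have xx: "x \<otimes> x \<in> {x, x \<oplus> s}"
      using not eight(1)[OF xy] eight(3)[OF xy] by blast
    then have "x \<otimes> (x \<otimes> x) = x \<otimes> x" by (auto simp: r_distr)
    then have "(x \<otimes> x) \<otimes> (\<one> \<ominus> x) = \<zero>"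
      by (simp add: a_minus_def r_distr r_minus m_assoc r_neg)
    then have "x \<otimes> x = \<zero>"
      using unit_mult_eq_zero(2)[of "\<one> \<ominus> x" "x \<otimes> x"] one_minus_nonunit xy by simp
    then show False using not by simp
  qed
  \<comment> \<open>By \<open>sq\<close>, both x(xy) and (xy)y vanish. In the coset of x or of y,
    one of these two products would equal xy. In the coset of x + y, the first gives xy = -x^2,
    which commutes with x although no element of that coset does.\<close>
  have prod: "x \<otimes> y = \<zero> \<or> x \<otimes> y = s"
    if xy: "x \<in> nonunits" "y \<in> nonunits" "x \<otimes> y \<noteq> y \<otimes> x" for x y
  proof (rule ccontr)
    assume not: "\<not> ?thesis"
    note [simp] = nonunits_closed[OF s(1)] nonunits_closed[OF xy(1)] nonunits_closed[OF xy(2)]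
      ann[rule_format, OF xy(1)] ann[rule_format, OF xy(2)]
    have "(x \<otimes> x) \<otimes> y = \<zero>" using sq[OF xy] by (elim disjE) simp_all
    then have 1: "x \<otimes> (x \<otimes> y) = \<zero>" by (simp add: m_assoc)
    have "x \<otimes> (y \<otimes> y) = \<zero>" using sq[OF xy(2,1) xy(3)[symmetric]] by (elim disjE) simp_all
    then have 2: "(x \<otimes> y) \<otimes> y = \<zero>" by (simp add: m_assoc)
    have "x \<otimes> y \<in> nonunits" using xy nonunits_mult by simp
    then consider "x \<otimes> y \<in> {x, x \<oplus> s}" | "x \<otimes> y \<in> {y, y \<oplus> s}" | "x \<otimes> y \<in> {x \<oplus> y, x \<oplus> y \<oplus> s}"
      using not eight(1)[OF xy] by blast
    then show False
    proof cases
      case 1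
      then have "(x \<otimes> y) \<otimes> y = x \<otimes> y" by (auto simp: l_distr)
      then show False using 2 not by simp
    next
      case 2
      then have "x \<otimes> (x \<otimes> y) = x \<otimes> y" by (auto simp: r_distr)
      then show False using 1 not by simp
    next
      case 3
      then have "x \<otimes> (x \<otimes> y) = x \<otimes> x \<oplus> x \<otimes> y" by (auto simp: r_distr)
      then have "x \<otimes> y = \<ominus> (x \<otimes> x)" using 1 minus_equality[of "x \<otimes> y" "x \<otimes> x"] by (simp add: a_comm)
      then have "(x \<otimes> y) \<otimes> x = x \<otimes> (x \<otimes> y)" by (simp add: l_minus r_minus m_assoc)
      then show False using 3 eight(3)[OF xy] by blast
    qed
  qed
  \<comment> \<open>Both products lie in {0, s}, so vanishing together forces them to be
    equal.\<close>
  have "a \<otimes> b = \<zero> \<longleftrightarrow> b \<otimes> a = \<zero>" using reversible ab by auto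
  then show False using prod[OF ab nc] prod[OF ab(2,1)] nc by auto
qed

section \<open>Structure of the noncommutative local case\<close>

definition central where "central = {z \<in> carrier R. \<forall>x\<in>carrier R. z \<otimes> x = x \<otimes> z}"

lemma centralD: "z \<in> central \<Longrightarrow> x \<in> carrier R \<Longrightarrow> z \<otimes> x = x \<otimes> z"
  unfolding central_def by blast

text \<open>The nonunits and their translate by 1 are disjoint, so at most half of the ring consists
  of nonunits and \<open>nonunits_commute\<close> applies. The central summands commute with
  everything.\<close>

lemma commutative_if_central_plus_nonunits:
  assumes order: "order R \<le> 16"
    and dec: "\<And>x. x \<in> carrier R \<Longrightarrow> \<exists>z\<in>central. \<exists>n\<in>nonunits. x = z \<oplus> n"
    and xy: "x \<in> carrier R" "y \<in> carrier R"
  shows "x \<otimes> y = y \<otimes> x"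
proof -
  have fin: "finite nonunits" using finite_carrier by (simp add: nonunits_def)
  have "nonunits \<inter> (\<lambda>n. \<one> \<oplus> n) ` nonunits = {}"
  proof -
    have "\<one> \<oplus> n \<notin> nonunits" if "n \<in> nonunits" for n
    proof
      assume "\<one> \<oplus> n \<in> nonunits"
      then have "\<one> \<oplus> n \<ominus> n \<in> nonunits" using that nonunits_minus by simp
      moreover have "\<one> \<oplus> n \<ominus> n = \<one>" using that by (simp add: a_minus_def a_assoc r_neg)
      ultimately show False by simp
    qed
    then show ?thesis by blast
  qed
  moreover have "card ((\<lambda>n. \<one> \<oplus> n) ` nonunits) = card nonunits"
    by (rule card_image) (auto intro: inj_onI)
  moreover have "nonunits \<union> (\<lambda>n. \<one> \<oplus> n) ` nonunits \<subseteq> carrier R" by auto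
  ultimately have "card nonunits + card nonunits \<le> order R"
    using fin finite_carrier card_mono unfolding order_def
    by (metis card_Un_disjoint finite_imageI)
  then have card: "card nonunits \<le> 8" using order by simp
  obtain z n z' n' where d: "z \<in> central" "n \<in> nonunits" "x = z \<oplus> n" "z' \<in> central" "n' \<in> nonunits" "y = z' \<oplus> n'"
    using dec xy by metis
  have [simp]: "z \<in> carrier R" "z' \<in> carrier R" "n \<in> carrier R" "n' \<in> carrier R"
    using d unfolding central_def by simp_all
  have zc: "z' \<otimes> z = z \<otimes> z'" "n' \<otimes> z = z \<otimes> n'" "n \<otimes> z' = z' \<otimes> n"
    using centralD[OF d(1), of z'] centralD[OF d(1), of n'] centralD[OF d(4), of n] by simp_all
  have nn: "n \<otimes> n' = n' \<otimes> n" using nonunits_commute[OF card d(2,5)] .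
  have "x \<otimes> y = (z \<otimes> z' \<oplus> n \<otimes> z') \<oplus> (z \<otimes> n' \<oplus> n \<otimes> n')"
    unfolding d by (simp add: l_distr r_distr)
  also have "\<dots> = (z' \<otimes> z \<oplus> n' \<otimes> z) \<oplus> (z' \<otimes> n \<oplus> n' \<otimes> n)"
    unfolding zc nn by (simp add: a_ac)
  also have "\<dots> = y \<otimes> x"
    unfolding d by (simp add: l_distr r_distr)
  finally show ?thesis .
qed

lemma noncommutative_structure:
  assumes nc: "x0 \<in> carrier R" "y0 \<in> carrier R" "x0 \<otimes> y0 \<noteq> y0 \<otimes> x0"
    and order: "order R \<le> 16"
  shows "order R = 16" "R \<simeq> F4_skew_quot"
proof -
  have "\<exists>w\<in>carrier R. \<forall>z\<in>central. \<forall>n\<in>nonunits. w \<noteq> z \<oplus> n"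
    using commutative_if_central_plus_nonunits[OF order _ nc(1,2)] nc(3) by blast
  then obtain w where w [simp]: "w \<in> carrier R"
    and wzn: "\<And>z n. z \<in> central \<Longrightarrow> n \<in> nonunits \<Longrightarrow> w \<noteq> z \<oplus> n"
    by blast
  have "nonunits \<noteq> {\<zero>}" using division_commutative[OF _ order nc(1,2)] nc(3) by blast
  then obtain s where s: "s \<in> nonunits" "s \<noteq> \<zero>"
    and ann: "\<forall>x\<in>nonunits. s \<otimes> x = \<zero> \<and> x \<otimes> s = \<zero>"
    by (rule socle_element) blast
  have s_carr [simp]: "s \<in> carrier R" using s by simp
  have ss: "s \<otimes> s = \<zero>" using ann s by blast
  have central [simp]: "\<zero> \<in> central" "\<one> \<in> central" "\<ominus> \<one> \<in> central"
    by (auto simp: central_def l_minus r_minus)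
  \<comment> \<open>These are representatives of the cosets of the nonunits, and in the end the
    image of the four-element field.\<close>
  define F where "F = {\<zero>, \<one>, w, w \<oplus> \<one>}"
  have F_closed [simp]: "c \<in> carrier R" if "c \<in> F" for c using that by (auto simp: F_def)
  have wN: "w \<notin> nonunits" using wzn[of \<zero> w] by auto
  have w1: "w \<ominus> \<one> \<notin> nonunits"
  proof -
    have "w = \<one> \<oplus> (w \<ominus> \<one>)" using w by algebra
    then show ?thesis using wzn[of \<one> "w \<ominus> \<one>"] by auto
  qed
  have w2: "w \<oplus> \<one> \<notin> nonunits"
  proof -
    have "w = \<ominus> \<one> \<oplus> (w \<oplus> \<one>)" using w by algebra
    then show ?thesis using wzn[of "\<ominus> \<one>" "w \<oplus> \<one>"] by auto
  qed
  \<comment> \<open>Up to sign the differences are 1, w, w - 1 and w + 1. They are units because 0,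
    1 and -1 are central while w is not central modulo nonunits.\<close>
  have F_diff: "c \<ominus> d \<notin> nonunits" if "c \<in> F" "d \<in> F" "c \<noteq> d" for c d
  proof -
    have z: "u \<ominus> \<zero> = u" if "u \<in> carrier R" for u using that by (simp add: a_minus_def)
    have "w \<oplus> \<one> \<ominus> w = \<one>" "w \<oplus> \<one> \<ominus> \<one> = w" using w by algebra+
    then have 1: "\<one> \<ominus> \<zero> \<notin> nonunits" "w \<ominus> \<zero> \<notin> nonunits" "w \<oplus> \<one> \<ominus> \<zero> \<notin> nonunits" "w \<ominus> \<one> \<notin> nonunits"
      "w \<oplus> \<one> \<ominus> w \<notin> nonunits" "w \<oplus> \<one> \<ominus> \<one> \<notin> nonunits"
      using wN w1 w2 by (simp_all add: z)
    then have "\<zero> \<ominus> \<one> \<notin> nonunits" "\<zero> \<ominus> w \<notin> nonunits" "\<zero> \<ominus> (w \<oplus> \<one>) \<notin> nonunits" "\<one> \<ominus> w \<notin> nonunits"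
      "w \<ominus> (w \<oplus> \<one>) \<notin> nonunits" "\<one> \<ominus> (w \<oplus> \<one>) \<notin> nonunits"
      using minus_nonunit_commute by (metis w one_closed zero_closed a_closed)+
    with 1 show ?thesis using that unfolding F_def by blast
  qed
  have F_unit: "c \<notin> nonunits" if "c \<in> F" "c \<noteq> \<zero>" for c
    using F_diff[of c \<zero>] that by (simp add: F_def a_minus_def)
  have card_F: "card F = 4"
  proof -
    have "w \<noteq> \<one>" using w1 minus_eq_zero_iff[OF w one_closed] zero_nonunit by metis
    moreover have "w \<noteq> \<zero>" "w \<oplus> \<one> \<noteq> \<zero>" using wN w2 by auto
    ultimately have "\<one> \<noteq> w" "w \<noteq> \<zero>" "w \<oplus> \<one> \<noteq> \<zero>" by auto
    moreover from this have "\<zero> \<noteq> w" "\<zero> \<noteq> w \<oplus> \<one>" by metis+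
    ultimately show ?thesis using one_not_zero one_not_zero[symmetric] unfolding F_def by simp
  qed
  have fin: "finite nonunits" using finite_carrier by (simp add: nonunits_def)
  \<comment> \<open>Distinct elements of \<open>F\<close> lie in distinct cosets. Hence four times
    the number of nonunits is at most 16.\<close>
  have "inj_on (\<lambda>(c, n). c \<oplus> n) (F \<times> nonunits)"
  proof (rule inj_onI, clarify)
    fix c n d m assume cd: "c \<in> F" "d \<in> F" and nm: "n \<in> nonunits" "m \<in> nonunits" and eq: "c \<oplus> n = d \<oplus> m"
    have "c \<ominus> d = (c \<oplus> n) \<ominus> d \<ominus> n"
      using F_closed[OF cd(1)] F_closed[OF cd(2)] nonunits_closed[OF nm(1)] by algebra
    also have "\<dots> = m \<ominus> n"
      unfolding eq using F_closed[OF cd(2)] nonunits_closed[OF nm(1)] nonunits_closed[OF nm(2)] by algebra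
    finally have "c \<ominus> d \<in> nonunits" using nonunits_minus nm by simp
    then have "c = d" using F_diff cd by blast
    then show "c = d \<and> n = m" using eq cd nm by simp
  qed
  then have card_im: "card ((\<lambda>(c, n). c \<oplus> n) ` (F \<times> nonunits)) = 4 * card nonunits"
    by (simp add: card_image card_cartesian_product card_F)
  have im: "(\<lambda>(c, n). c \<oplus> n) ` (F \<times> nonunits) \<subseteq> carrier R" by auto
  then have le: "4 * card nonunits \<le> order R"
    unfolding card_im[symmetric] order_def by (rule card_mono[OF finite_carrier])
  \<comment> \<open>Differences in \<open>F\<close> are units and cannot kill \<open>s\<close>. The
    four multiples of \<open>s\<close> therefore fill the nonunits, which fixes both
    cardinalities.\<close>
  have "inj_on (\<lambda>c. c \<otimes> s) F"
  proof (rule inj_onI, rule ccontr)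
    fix c d assume cd: "c \<in> F" "d \<in> F" and eq: "c \<otimes> s = d \<otimes> s" and ne: "c \<noteq> d"
    have "(c \<ominus> d) \<otimes> s = \<zero>" using cd eq by (simp add: l_distr_minus minus_eq_zero_iff)
    then show False using unit_mult_eq_zero(1)[of "c \<ominus> d" s] F_diff[OF cd ne] cd s by simp
  qed
  then have card_Fs: "card ((\<lambda>c. c \<otimes> s) ` F) = 4" by (simp add: card_image card_F)
  have Fs: "(\<lambda>c. c \<otimes> s) ` F \<subseteq> nonunits" using s nonunits_mult by auto
  have "card nonunits \<le> 4" using le order by simp
  then have nonunits_eq: "(\<lambda>c. c \<otimes> s) ` F = nonunits"
    using card_seteq[OF fin Fs] card_Fs by simp
  then have card_N: "card nonunits = 4" using card_Fs by simp
  then show order_eq: "order R = 16" using le order by simp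
  have carrier_eq: "(\<lambda>(c, n). c \<oplus> n) ` (F \<times> nonunits) = carrier R"
    using card_seteq[OF finite_carrier im] card_im card_N order_eq by (simp add: order_def)
  have coset: "\<exists>c\<in>F. \<exists>n\<in>nonunits. x = c \<oplus> n" if "x \<in> carrier R" for x
    using that unfolding carrier_eq[symmetric] by auto
  have multiple: "\<exists>c\<in>F. n = c \<otimes> s" if "n \<in> nonunits" for n
    using that unfolding nonunits_eq[symmetric] by auto
  have gen: "\<exists>a\<in>F. \<exists>b\<in>F. x = a \<oplus> b \<otimes> s" if "x \<in> carrier R" for x
    using coset[OF that] multiple by blast
  \<comment> \<open>If s and w commuted, then so would all elements a + b s with a, b in
    \<open>F\<close>, which are all elements of the ring.\<close>
  have not_comm: "s \<otimes> w \<noteq> w \<otimes> s"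
  proof
    assume sw: "s \<otimes> w = w \<otimes> s"
    have FF: "c \<otimes> d = d \<otimes> c" if "c \<in> F" "d \<in> F" for c d
      using that by (auto simp: F_def l_distr r_distr)
    have Fs: "s \<otimes> c = c \<otimes> s" if "c \<in> F" for c
      using that sw by (auto simp: F_def l_distr r_distr)
    obtain a b c d where F: "a \<in> F" "b \<in> F" "c \<in> F" "d \<in> F" and xy: "x0 = a \<oplus> b \<otimes> s" "y0 = c \<oplus> d \<otimes> s"
      using gen nc(1,2) by metis
    have zero: "u \<otimes> s \<otimes> (v \<otimes> s) = \<zero>" if "u \<in> F" "v \<in> F" for u v
    proof -
      have "u \<otimes> s \<otimes> (v \<otimes> s) = u \<otimes> (s \<otimes> v) \<otimes> s" using that by (simp add: m_assoc)
      also have "\<dots> = u \<otimes> v \<otimes> (s \<otimes> s)" unfolding Fs[OF that(2)] using that by (simp add: m_assoc)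
      finally show ?thesis using that ss by simp
    qed
    have cross: "u \<otimes> (v \<otimes> s) = v \<otimes> s \<otimes> u" if "u \<in> F" "v \<in> F" for u v
    proof -
      have "v \<otimes> s \<otimes> u = v \<otimes> (s \<otimes> u)" using that by (simp add: m_assoc)
      also have "\<dots> = (v \<otimes> u) \<otimes> s" unfolding Fs[OF that(1)] using that by (simp add: m_assoc)
      also have "\<dots> = u \<otimes> (v \<otimes> s)" unfolding FF[OF that(2,1)] using that by (simp add: m_assoc)
      finally show ?thesis ..
    qed
    have "x0 \<otimes> y0 = a \<otimes> c \<oplus> b \<otimes> s \<otimes> c \<oplus> a \<otimes> (d \<otimes> s)"
      unfolding xy using F zero[OF F(2,4)] by (simp add: l_distr r_distr a_assoc)
    also have "\<dots> = c \<otimes> a \<oplus> c \<otimes> (b \<otimes> s) \<oplus> d \<otimes> s \<otimes> a"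
      unfolding FF[OF F(1,3)] cross[OF F(3,2)] cross[OF F(1,4)] ..
    also have "\<dots> = y0 \<otimes> x0"
      unfolding xy using F zero[OF F(4,2)] by (simp add: l_distr r_distr a_ac)
    finally show False using nc(3) by blast
  qed
  \<comment> \<open>Such an n is c s with c in \<open>F\<close> commuting with w, so c (sw - ws) = 0
    and c cannot be a unit. This turns congruences modulo nonunits into equalities whenever the
    difference commutes with w.\<close>
  have comm_zero: "n = \<zero>" if n: "n \<in> nonunits" and nw: "n \<otimes> w = w \<otimes> n" for n
  proof (rule ccontr)
    assume "n \<noteq> \<zero>"
    obtain c where c: "c \<in> F" "n = c \<otimes> s" using multiple[OF n] by blast
    then have "c \<noteq> \<zero>" using \<open>n \<noteq> \<zero>\<close> by auto
    have "c \<otimes> w = w \<otimes> c" using c(1) by (auto simp: F_def l_distr r_distr)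
    then have "c \<otimes> (w \<otimes> s) = w \<otimes> (c \<otimes> s)" using c by (simp flip: m_assoc)
    then have "c \<otimes> (s \<otimes> w) = c \<otimes> (w \<otimes> s)" using c nw by (simp add: m_assoc)
    then have "c \<otimes> (s \<otimes> w \<ominus> w \<otimes> s) = \<zero>" using c by (simp add: r_distr_minus minus_eq_zero_iff)
    then show False
      using unit_mult_eq_zero(1)[of c "s \<otimes> w \<ominus> w \<otimes> s"] F_unit[OF c(1) \<open>c \<noteq> \<zero>\<close>] c(1) not_comm
      by (simp add: minus_eq_zero_iff)
  qed
  have coset': "\<exists>c\<in>F. x \<ominus> c \<in> nonunits" if x: "x \<in> carrier R" for x
  proof -
    obtain c n where cn: "c \<in> F" "n \<in> nonunits" "x = c \<oplus> n" using coset[OF x] by blast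
    have "c \<oplus> n \<ominus> c = n" using F_closed[OF cn(1)] nonunits_closed[OF cn(2)] by algebra
    then show ?thesis using cn by (intro bexI[of _ c]) simp_all
  qed
  \<comment> \<open>Since 2 commutes with w, it suffices that 2 is a nonunit. Its representative c
    in \<open>F\<close> is not 1, because 1 is a unit. The value w would make w central modulo
    nonunits, and w + 1 would make w - 1 a nonunit.\<close>
  have char2: "\<one> \<oplus> \<one> = \<zero>"
  proof (rule comm_zero)
    obtain c where c: "c \<in> F" "\<one> \<oplus> \<one> \<ominus> c \<in> nonunits" using coset'[of "\<one> \<oplus> \<one>"] by auto
    have "c \<noteq> \<one>"
    proof
      assume "c = \<one>"
      moreover have "\<one> \<oplus> \<one> \<ominus> \<one> = \<one>" by algebra
      ultimately show False using c by simp
    qed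
    moreover have "c \<noteq> w"
    proof
      assume "c = w"
      then have "w \<ominus> (\<one> \<oplus> \<one>) \<in> nonunits" using c minus_nonunit_commute by simp
      moreover have "w = \<one> \<oplus> \<one> \<oplus> (w \<ominus> (\<one> \<oplus> \<one>))" using w by algebra
      moreover have "\<one> \<oplus> \<one> \<in> central" by (auto simp: central_def l_distr r_distr)
      ultimately show False using wzn by blast
    qed
    moreover have "c \<noteq> w \<oplus> \<one>"
    proof
      assume "c = w \<oplus> \<one>"
      then have "w \<oplus> \<one> \<ominus> (\<one> \<oplus> \<one>) \<in> nonunits" using c minus_nonunit_commute by simp
      moreover have "w \<oplus> \<one> \<ominus> (\<one> \<oplus> \<one>) = w \<ominus> \<one>" using w by algebra
      ultimately show False using w1 by simp
    qed
    ultimately have "c = \<zero>" using c(1) by (auto simp: F_def)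
    then show "\<one> \<oplus> \<one> \<in> nonunits" using c by (simp add: a_minus_def)
  qed (simp add: l_distr r_distr)
  \<comment> \<open>If the representative of w^2 were 0, 1 or w, then w w, (w - 1)(w + 1) or w (w -
    1) would be a nonunit product of units. The remaining congruence is an equality by
    \<open>comm_zero\<close>.\<close>
  have ww: "w \<otimes> w = w \<oplus> \<one>"
  proof -
    obtain c where c: "c \<in> F" "w \<otimes> w \<ominus> c \<in> nonunits" using coset'[of "w \<otimes> w"] by auto
    have "c \<noteq> \<zero>"
      using c mult_nonunitD[of w w] wN by (auto simp: a_minus_def)
    moreover have "c \<noteq> \<one>"
    proof
      assume "c = \<one>"
      moreover have "(w \<ominus> \<one>) \<otimes> (w \<oplus> \<one>) = w \<otimes> w \<oplus> w \<ominus> (w \<oplus> \<one>)"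
        by (subst l_distr_minus) (simp_all add: r_distr)
      moreover have "w \<otimes> w \<oplus> w \<ominus> (w \<oplus> \<one>) = w \<otimes> w \<ominus> \<one>" using w by algebra
      ultimately show False using c mult_nonunitD[of "w \<ominus> \<one>" "w \<oplus> \<one>"] w1 w2 by simp
    qed
    moreover have "c \<noteq> w"
      using c mult_nonunitD[of w "w \<ominus> \<one>"] wN w1 by (auto simp: r_distr_minus)
    ultimately have "c = w \<oplus> \<one>" using c(1) by (auto simp: F_def)
    then have "w \<otimes> w \<ominus> (w \<oplus> \<one>) = \<zero>"
      using c by (intro comm_zero) (simp_all add: l_distr_minus r_distr_minus l_distr r_distr m_assoc)
    then show ?thesis by (simp add: minus_eq_zero_iff)
  qed
  \<comment> \<open>The nonunit sw is c s with c in \<open>F\<close>. For c = 0 or c = 1 a unit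
    would annihilate s, and c = w contradicts \<open>not_comm\<close>.\<close>
  have sw: "s \<otimes> w = (w \<oplus> \<one>) \<otimes> s"
  proof -
    have "s \<otimes> w \<in> nonunits" using s nonunits_mult by simp
    then obtain c where c: "c \<in> F" "s \<otimes> w = c \<otimes> s" using multiple by blast
    have "c \<noteq> \<zero>" using c unit_mult_eq_zero(2)[of w s] wN s by auto
    moreover have "c \<noteq> \<one>"
    proof
      assume "c = \<one>"
      then have "s \<otimes> (w \<ominus> \<one>) = \<zero>" using c by (simp add: r_distr_minus minus_eq_zero_iff)
      then show False using unit_mult_eq_zero(2)[of "w \<ominus> \<one>" s] w1 s by simp
    qed
    moreover have "c \<noteq> w" using c not_comm by auto
    ultimately have "c = w \<oplus> \<one>" using c(1) by (auto simp: F_def)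
    then show ?thesis using c by simp
  qed
  show "R \<simeq> F4_skew_quot"
    by (rule iso_F4_skew_quot[OF ring_axioms w s_carr char2 ww ss sw gen[unfolded F_def] order_eq])
qed

end

section \<open>Corners at idempotents\<close>

definition (in finite_reversible_ring) corner
  where "corner e = R\<lparr>carrier := {x \<in> carrier R. e \<otimes> x = x}, one := e\<rparr>"

text \<open>The corner is cut out by a condition on the left only. Centrality of e makes e a unity
  on the right as well.\<close>

lemma (in finite_reversible_ring) corner_ring:
  assumes e: "e \<in> carrier R" "e \<otimes> e = e"
  shows "finite_reversible_ring (corner e)"
proof -
  have ec: "x \<otimes> e = x" if "x \<in> carrier R" "e \<otimes> x = x" for x
    using idempotent_central[OF e that(1)] that(2) by simp
  have neg: "\<exists>y\<in>{x \<in> carrier R. e \<otimes> x = x}. y \<oplus> x = \<zero>" if "x \<in> carrier R" "e \<otimes> x = x" for x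
    using that e by (intro bexI[of _ "\<ominus> x"]) (simp_all add: l_neg r_minus)
  have "ring (corner e)"
  proof (rule ringI[OF abelian_groupI monoidI])
    show "\<exists>y\<in>carrier (corner e). y \<oplus>\<^bsub>corner e\<^esub> x = \<zero>\<^bsub>corner e\<^esub>"
      if "x \<in> carrier (corner e)" for x
      using that neg by (simp add: corner_def)
  qed (use e ec in \<open>auto simp: corner_def r_distr l_distr a_ac m_assoc simp flip: m_assoc[of e]\<close>)
  then interpret C: ring "corner e" .
  show ?thesis
    by unfold_locales (use finite_carrier reversible in \<open>auto simp: corner_def\<close>)
qed

text \<open>The corner is disjoint from its translate by 1 - e, since multiplication by e removes
  the added 1 - e.\<close>

lemma (in finite_reversible_ring) corner_small:
  assumes e: "e \<in> carrier R" "e \<otimes> e = e" "e \<noteq> \<one>"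
  shows "2 * order (corner e) \<le> order R"
proof -
  let ?C = "{x \<in> carrier R. e \<otimes> x = x}"
  have fin: "finite ?C" using finite_carrier by simp
  have "?C \<inter> (\<lambda>x. \<one> \<ominus> e \<oplus> x) ` ?C = {}"
  proof -
    have "\<one> \<ominus> e = \<zero>" if "x \<in> ?C" "\<one> \<ominus> e \<oplus> x \<in> ?C" for x
    proof -
      have x: "x \<in> carrier R" "e \<otimes> x = x" "e \<otimes> (\<one> \<ominus> e \<oplus> x) = \<one> \<ominus> e \<oplus> x" using that by auto
      have "e \<otimes> (\<one> \<ominus> e \<oplus> x) = x"
        using e x(1,2) by (simp add: a_minus_def r_distr r_minus r_neg)
      then have "\<one> \<ominus> e \<oplus> x = x" using x(3) by simp
      then show ?thesis using e x(1) by simp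
    qed
    then show ?thesis using e minus_eq_zero_iff[of \<one> e] by blast
  qed
  moreover have "card ((\<lambda>x. \<one> \<ominus> e \<oplus> x) ` ?C) = card ?C"
    using e by (intro card_image inj_onI) simp
  moreover have "?C \<union> (\<lambda>x. \<one> \<ominus> e \<oplus> x) ` ?C \<subseteq> carrier R" using e by auto
  ultimately have "card ?C + card ?C \<le> card (carrier R)"
    using fin finite_carrier card_mono by (metis (no_types, lifting) card_Un_disjoint finite_imageI)
  then show ?thesis by (simp add: order_def corner_def)
qed

text \<open>As e is central and idempotent, multiplication by e is multiplicative, so ex and ey are
  the required pair.\<close>

lemma (in finite_reversible_ring) corner_noncommutative:
  assumes e: "e \<in> carrier R" "e \<otimes> e = e"
    and xy: "x \<in> carrier R" "y \<in> carrier R" "e \<otimes> (x \<otimes> y) \<noteq> e \<otimes> (y \<otimes> x)"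
  shows "\<exists>x\<in>carrier (corner e). \<exists>y\<in>carrier (corner e). x \<otimes>\<^bsub>corner e\<^esub> y \<noteq> y \<otimes>\<^bsub>corner e\<^esub> x"
proof -
  have m: "e \<otimes> u \<otimes> (e \<otimes> v) = e \<otimes> (u \<otimes> v)" if "u \<in> carrier R" "v \<in> carrier R" for u v
  proof -
    have "e \<otimes> u \<otimes> (e \<otimes> v) = e \<otimes> (u \<otimes> e) \<otimes> v" using that e by (simp add: m_assoc)
    also have "\<dots> = (e \<otimes> e) \<otimes> u \<otimes> v"
      unfolding idempotent_central[OF e that(1), symmetric] using that e(1) by (simp add: m_assoc)
    finally show ?thesis using that e by (simp add: m_assoc)
  qed
  have c: "e \<otimes> u \<in> carrier (corner e)" if "u \<in> carrier R" for u
    using that e by (simp add: corner_def flip: m_assoc)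
  show ?thesis
    by (rule bexI[OF _ c[OF xy(1)]], rule bexI[OF _ c[OF xy(2)]]) (use xy m in \<open>simp add: corner_def\<close>)
qed

text \<open>Peirce decomposition: every element is the sum of its products with e and 1 - e, and
  both are idempotents other than 1.\<close>

lemma (in finite_reversible_ring) commute_if_corners_commute:
  assumes e: "e \<in> carrier R" "e \<otimes> e = e" "e \<noteq> \<zero>" "e \<noteq> \<one>"
    and xy: "x \<in> carrier R" "y \<in> carrier R"
    and corners: "\<And>f. f \<in> carrier R \<Longrightarrow> f \<otimes> f = f \<Longrightarrow> f \<noteq> \<one> \<Longrightarrow> f \<otimes> (x \<otimes> y) = f \<otimes> (y \<otimes> x)"
  shows "x \<otimes> y = y \<otimes> x"
proof -
  have "(\<one> \<ominus> e) \<otimes> (\<one> \<ominus> e) = (\<one> \<ominus> e) \<ominus> (\<one> \<ominus> e) \<otimes> e"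
    using e(1) by (simp add: a_minus_def r_distr r_minus)
  also have "(\<one> \<ominus> e) \<otimes> e = \<zero>"
    using e by (simp add: a_minus_def l_distr l_minus r_neg)
  finally have idem: "(\<one> \<ominus> e) \<otimes> (\<one> \<ominus> e) = \<one> \<ominus> e" using e(1) by (simp add: a_minus_def)
  have ne1: "\<one> \<ominus> e \<noteq> \<one>" using e by (simp add: a_minus_def)
  have sum: "e \<oplus> (\<one> \<ominus> e) = \<one>" using e(1) by (simp add: a_minus_def a_lcomm[of e] r_neg)
  have "x \<otimes> y = e \<otimes> (x \<otimes> y) \<oplus> (\<one> \<ominus> e) \<otimes> (x \<otimes> y)"
    using xy e(1) by (simp add: sum flip: l_distr)
  also have "\<dots> = e \<otimes> (y \<otimes> x) \<oplus> (\<one> \<ominus> e) \<otimes> (y \<otimes> x)"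
    using corners[OF e(1,2,4)] corners[OF _ idem ne1] e(1) by simp
  also have "\<dots> = y \<otimes> x"
    using xy e(1) by (simp add: sum flip: l_distr)
  finally show ?thesis .
qed

section \<open>Induction on the order and conclusion\<close>

text \<open>A noncommutative corner at an idempotent other than 1 would have order 16 by induction,
  but it has at most 8 elements. So these corners are commutative, a nontrivial idempotent would
  make x and y commute, and the local case remains.\<close>

theorem finite_reversible_noncommutative:
  fixes R :: "('a, 'm) ring_scheme"
  assumes "finite_reversible_ring R" "order R \<le> 16"
    and "x \<in> carrier R" "y \<in> carrier R" "x \<otimes>\<^bsub>R\<^esub> y \<noteq> y \<otimes>\<^bsub>R\<^esub> x"
  shows "order R = 16 \<and> R \<simeq> F4_skew_quot"
  using assms
proof (induction "order R" arbitrary: R x y rule: less_induct)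
  case less
  interpret finite_reversible_ring R by (rule less.prems)
  have one: "\<one>\<^bsub>R\<^esub> \<noteq> \<zero>\<^bsub>R\<^esub>"
    using less.prems(3-5) by (metis l_one l_null)
  have corners: "f \<otimes>\<^bsub>R\<^esub> (x \<otimes>\<^bsub>R\<^esub> y) = f \<otimes>\<^bsub>R\<^esub> (y \<otimes>\<^bsub>R\<^esub> x)"
    if f: "f \<in> carrier R" "f \<otimes>\<^bsub>R\<^esub> f = f" "f \<noteq> \<one>\<^bsub>R\<^esub>" for f
  proof (rule ccontr)
    assume "f \<otimes>\<^bsub>R\<^esub> (x \<otimes>\<^bsub>R\<^esub> y) \<noteq> f \<otimes>\<^bsub>R\<^esub> (y \<otimes>\<^bsub>R\<^esub> x)"
    then obtain u v where uv: "u \<in> carrier (corner f)" "v \<in> carrier (corner f)"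
      "u \<otimes>\<^bsub>corner f\<^esub> v \<noteq> v \<otimes>\<^bsub>corner f\<^esub> u"
      using corner_noncommutative[OF f(1,2) less.prems(3,4)] by blast
    have small: "2 * order (corner f) \<le> order R" by (rule corner_small[OF f])
    \<comment> \<open>Positivity makes the halved order strictly smaller, as the induction
      hypothesis demands.\<close>
    have pos: "order R > 0"
      using finite_carrier zero_closed by (auto simp: order_def card_gt_0_iff)
    have "order (corner f) = 16"
      using less.hyps[OF _ corner_ring[OF f(1,2)] _ uv] small pos less.prems(2) by linarith
    then show False using small less.prems(2) by simp
  qed
  have "e = \<zero>\<^bsub>R\<^esub> \<or> e = \<one>\<^bsub>R\<^esub>" if "e \<in> carrier R" "e \<otimes>\<^bsub>R\<^esub> e = e" for e
    using commute_if_corners_commute[OF that _ _ less.prems(3,4) corners] less.prems(5) by blast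
  with one interpret finite_reversible_local_ring R by unfold_locales
  show ?case using noncommutative_structure[OF less.prems(3,4,5,2)] by blast
qed

lemma symmetric_ring_finite_reversible:
  assumes "symmetric_ring R" "finite (carrier R)"
  shows "finite_reversible_ring R"
proof -
  interpret symmetric_ring R by fact
  show ?thesis
    using assms(2) symmetric[of _ _ "\<one>\<^bsub>R\<^esub>"] by unfold_locales auto
qed

theorem theorem3p8:
  fixes R :: "('a, 'm) ring_scheme"
  shows
    "(symmetric_ring F4_skew_quot \<and> duo_ring F4_skew_quot \<and>
      noncommutative_ring F4_skew_quot \<and> order F4_skew_quot = 16) \<and>
     (symmetric_ring R \<and> duo_ring R \<and> noncommutative_ring R \<and> finite (carrier R)
        \<longrightarrow> 16 \<le> order R) \<and>
     (symmetric_ring R \<and> duo_ring R \<and> noncommutative_ring R \<and> order R = 16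
        \<longrightarrow> R \<simeq> F4_skew_quot)"
proof -
  \<comment> \<open>Both the lower bound and uniqueness come from this one classification up to
    order 16.\<close>
  have main: "order R = 16 \<and> R \<simeq> F4_skew_quot"
    if R: "symmetric_ring R" "noncommutative_ring R" "finite (carrier R)" "order R \<le> 16"
  proof -
    obtain a b where "a \<in> carrier R" "b \<in> carrier R" "a \<otimes>\<^bsub>R\<^esub> b \<noteq> b \<otimes>\<^bsub>R\<^esub> a"
      using R(2) unfolding noncommutative_ring_iff by blast
    then show ?thesis
      by (rule finite_reversible_noncommutative[OF symmetric_ring_finite_reversible[OF R(1,3)] R(4)])
  qed
  have "16 \<le> order R" if "symmetric_ring R" "noncommutative_ring R" "finite (carrier R)"
    using main[OF that] by (cases "order R \<le> 16") simp_all
  moreover have "R \<simeq> F4_skew_quot" if "symmetric_ring R" "noncommutative_ring R" "order R = 16"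
  proof -
    \<comment> \<open>The order is a \<open>card\<close>, which is 0 on infinite sets, so the value
      16 forces finiteness.\<close>
    have "finite (carrier R)" using that(3) by (intro card_ge_0_finite) (simp add: order_def)
    then show ?thesis using main[OF that(1,2)] that(3) by simp
  qed
  ultimately show ?thesis using F4_skew_quot_properties by blast
qed

end
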